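(* Let $V_0$ be a bounded potential on the half-line (continuum or discrete case), and let $W$ be a potential with $$\int |W(x)|\,e^{A|x|}\,dx<\infty\qquad\text{for all }A>0$$ (in the discrete case, $\sum_{n\ge 1}|W(n)|e^{An}<\infty$ for all $A>0$). Then $P(V_0)=P(V_0+W)$.
   Context: Continuum case: a potential is a real-valued locally integrable function $V$ on $[0,\infty)$, and one considers the equation $-\varphi''+V\varphi=\lambda\varphi$ on $[0,\infty)$. Discrete case: a potential is a function $V:\{1,2,\dots\}\to\mathbb{R}$, and one considers $\varphi(n+1)+\varphi(n-1)+V(n)\varphi(n)=\lambda\varphi(n)$ for $n\ge1$; $L^2$ means $\ell^2$. For $\theta\in\mathbb{R}$, $\varphi_{1,\theta}(\lambda,\cdot)$ is the solution with $\varphi_{1,\theta}(\lambda,0)=\sin\theta$, $\varphi_{1,\theta}'(\lambda,0)=-\cos\theta$ (discrete case: $\varphi_{1,\theta}(\lambda,0)=\sin\theta$, $\varphi_{1,\theta}(\lambda,1)=-\cos\theta$), and $\varphi_{2,\theta}:=\varphi_{1,\theta-\pi/2}$. For $L>0$, $\|f\|_L^2=\int_0^L|f(x)|^2dx$ in the continuum case, and $\|f\|_L^2=\sum_{n=1}^{[L]}|f(n)|^2+(L-[L])|f([L]+1)|^2$ in the discrete case. There is a subordinate solution at energy $\lambda\in\mathbb{R}$ if for some $\theta\in[0,\pi)$, $\lim_{L\to\infty}\|\varphi_{1,\theta}\|_L/\|\varphi_{2,\theta}\|_L=0$; this $\theta$ is necessarily unique and is denoted $\theta(\lambda)$. $P(V)$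 is the set of $\lambda\in\mathbb{R}$ for which there is a subordinate solution for the potential $V$ and $\varphi_{1,\theta(\lambda)}(\lambda,\cdot)\in L^2$. *)

theory Defs
  imports "HOL-Analysis.Analysis"
begin

section \<open>Continuum half-line operators\<close>

text \<open>Potentials and solutions live on the half-line from 0; values of a potential at negative
  arguments are irrelevant.\<close>

definition potential_c :: "(real \<Rightarrow> real) \<Rightarrow> bool" where
  "potential_c V \<longleftrightarrow> (\<forall>b\<ge>0. V absolutely_integrable_on {0..b})"

text \<open>Boundedness is essential boundedness, potentials being locally integrable functions.\<close>

definition bounded_c :: "(real \<Rightarrow> real) \<Rightarrow> bool" where
  "bounded_c V \<longleftrightarrow> (\<exists>C. AE x in lebesgue. x \<ge> 0 \<longrightarrow> \<bar>V x\<bar> \<le> C)"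

text \<open>Since \<open>V\<close> is only locally integrable, a solution is a \<open>C\<^sup>1\<close> function \<open>\<phi>\<close> whose derivative
  \<open>\<phi>'\<close> is locally absolutely continuous, i.e. the indefinite integral of a locally integrable
  function \<open>\<phi>''\<close>, with the differential equation holding almost everywhere. The derivative
  at 0 is one-sided.\<close>

definition solves_c :: "(real \<Rightarrow> real) \<Rightarrow> real \<Rightarrow> (real \<Rightarrow> real) \<Rightarrow> (real \<Rightarrow> real) \<Rightarrow> bool" where
  "solves_c V lam \<phi> \<phi>' \<longleftrightarrow>
     (\<forall>x\<ge>0. (\<phi> has_real_derivative \<phi>' x) (at x within {0..})) \<and>
     (\<exists>\<phi>''. (\<forall>b\<ge>0. \<phi>'' absolutely_integrable_on {0..b}) \<and>
            (\<forall>x\<ge>0. \<phi>' x = \<phi>' 0 + integral {0..x} \<phi>'') \<and>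
            (AE x in lebesgue. x \<ge> 0 \<longrightarrow> - \<phi>'' x + V x * \<phi> x = lam * \<phi> x))"

text \<open>The condition for negative arguments makes the solution unique as a total function.\<close>

definition phi1_c :: "(real \<Rightarrow> real) \<Rightarrow> real \<Rightarrow> real \<Rightarrow> real \<Rightarrow> real" where
  "phi1_c V \<theta> lam = (THE \<phi>. (\<forall>x<0. \<phi> x = 0) \<and>
     (\<exists>\<phi>'. solves_c V lam \<phi> \<phi>' \<and> \<phi> 0 = sin \<theta> \<and> \<phi>' 0 = - cos \<theta>))"

definition phi2_c :: "(real \<Rightarrow> real) \<Rightarrow> real \<Rightarrow> real \<Rightarrow> real \<Rightarrow> real" where
  "phi2_c V \<theta> = phi1_c V (\<theta> - pi / 2)"

definition normL_c :: "real \<Rightarrow> (real \<Rightarrow> real) \<Rightarrow> real" where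
  "normL_c L f = sqrt (integral {0..L} (\<lambda>x. \<bar>f x\<bar>\<^sup>2))"

definition subordinate_c :: "(real \<Rightarrow> real) \<Rightarrow> real \<Rightarrow> real \<Rightarrow> bool" where
  "subordinate_c V lam \<theta> \<longleftrightarrow>
     ((\<lambda>L. normL_c L (phi1_c V \<theta> lam) / normL_c L (phi2_c V \<theta> lam)) \<longlongrightarrow> 0) at_top"

definition theta_c :: "(real \<Rightarrow> real) \<Rightarrow> real \<Rightarrow> real" where
  "theta_c V lam = (THE \<theta>. \<theta> \<in> {0..<pi} \<and> subordinate_c V lam \<theta>)"

definition P_c :: "(real \<Rightarrow> real) \<Rightarrow> real set" where
  "P_c V = {lam. (\<exists>\<theta>\<in>{0..<pi}. subordinate_c V lam \<theta>) \<and>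
     (\<lambda>x. \<bar>phi1_c V (theta_c V lam) lam x\<bar>\<^sup>2) absolutely_integrable_on {0..}}"

section \<open>Discrete half-line operators\<close>

text \<open>Potentials are indexed by \<open>{1, 2, \<dots>}\<close>; the value at index 0 is never used.
  Solutions are indexed by \<open>{0, 1, \<dots>}\<close>.\<close>

definition solves_d :: "(nat \<Rightarrow> real) \<Rightarrow> real \<Rightarrow> (nat \<Rightarrow> real) \<Rightarrow> bool" where
  "solves_d V lam \<phi> \<longleftrightarrow> (\<forall>n\<ge>1. \<phi> (n + 1) + \<phi> (n - 1) + V n * \<phi> n = lam * \<phi> n)"

definition phi1_d :: "(nat \<Rightarrow> real) \<Rightarrow> real \<Rightarrow> real \<Rightarrow> nat \<Rightarrow> real" where
  "phi1_d V \<theta> lam = (THE \<phi>. solves_d V lam \<phi> \<and> \<phi> 0 = sin \<theta> \<and> \<phi> 1 = - cos \<theta>)"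

definition phi2_d :: "(nat \<Rightarrow> real) \<Rightarrow> real \<Rightarrow> real \<Rightarrow> nat \<Rightarrow> real" where
  "phi2_d V \<theta> = phi1_d V (\<theta> - pi / 2)"

definition normL_d :: "real \<Rightarrow> (nat \<Rightarrow> real) \<Rightarrow> real" where
  "normL_d L f = sqrt ((\<Sum>n = 1..nat \<lfloor>L\<rfloor>. \<bar>f n\<bar>\<^sup>2)
     + (L - of_int \<lfloor>L\<rfloor>) * \<bar>f (nat \<lfloor>L\<rfloor> + 1)\<bar>\<^sup>2)"

definition subordinate_d :: "(nat \<Rightarrow> real) \<Rightarrow> real \<Rightarrow> real \<Rightarrow> bool" where
  "subordinate_d V lam \<theta> \<longleftrightarrow>
     ((\<lambda>L. normL_d L (phi1_d V \<theta> lam) / normL_d L (phi2_d V \<theta> lam)) \<longlongrightarrow> 0) at_top"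

definition theta_d :: "(nat \<Rightarrow> real) \<Rightarrow> real \<Rightarrow> real" where
  "theta_d V lam = (THE \<theta>. \<theta> \<in> {0..<pi} \<and> subordinate_d V lam \<theta>)"

definition P_d :: "(nat \<Rightarrow> real) \<Rightarrow> real set" where
  "P_d V = {lam. (\<exists>\<theta>\<in>{0..<pi}. subordinate_d V lam \<theta>) \<and>
     (\<lambda>n. \<bar>phi1_d V (theta_d V lam) lam n\<bar>\<^sup>2) summable_on {1..}}"

end

theory Submission
  imports Defs
begin

text \<open>
  For any potential \<open>V\<close>, an energy lies in \<open>P(V)\<close> iff the equation has a nonzero square-integrable
  solution and also a solution that is not square-integrable: the norms of a linearly independent
  pair can only be in the subordinate relation if the second one is unbounded.

  A bounded potential plus an integrable one has solutions of at most exponential growth. If \<open>u\<close>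
  solves the equation for \<open>V\<^sub>1\<close> and \<open>v\<close> the one for \<open>V\<^sub>2\<close>, the Wronskian of \<open>u\<close> and \<open>v\<close> has derivative
  \<open>(V\<^sub>2 - V\<^sub>1) u v\<close>, so if \<open>V\<^sub>2 - V\<^sub>1\<close> decays superexponentially, the Wronskian converges
  superexponentially fast. Cramer's rule then writes \<open>u\<close> as a solution for \<open>V\<^sub>2\<close> plus a
  superexponentially small error. This correspondence is injective, because a superexponentially
  small solution has vanishing Wronskian with every other solution, and it preserves
  square-integrability and its negation; by symmetry \<open>P(V\<^sub>1) = P(V\<^sub>2)\<close>.
\<close>

section \<open>Subordinacy in a two-dimensional solution space\<close>

text \<open>The subordinate angle may change with the potential, so it is not carried across; what
  is carried across is the existence of solutions of two kinds. A nonzero square-integrable solution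
  is subordinate, up to scaling, as soon as some solution is not square-integrable: its norms stay
  bounded, while those of every independent solution increase to infinity.

  The growth rate \<open>B\<close> of the solutions depends on the energy. Two growing factors enter
  the Wronskian integrand, and Cramer's rule multiplies the remainder by one more, so decay of the
  perturbation at every exponential rate leaves any prescribed rate for the error. A fixed rate
  suffices for square-integrability; a rate beyond the growth rate gives injectivity, which in the
  continuum requires the same estimate for the derivative.

  The obstacle in the continuum is that potentials are only locally integrable: derivatives of
  solutions are indefinite integrals and the equation holds almost everywhere, so the Wronskian
  identity and the existence of solutions have to be obtained at that level.\<close>

lemma sin_cos_nonzero: "sin \<theta> \<noteq> 0 \<or> - cos \<theta> \<noteq> (0::real)"
  using sin_zero_norm_cos_one[of \<theta>] by fastforce

text \<open>Replaces initial data by a normalized angle. Angles in \<open>{0..<pi}\<close> describe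
  lines rather than rays, so \<open>r\<close> may be negative: a polar angle of \<open>pi\<close> or
  more is moved back by \<open>pi\<close>, which reverses both coordinates.\<close>

lemma polar_half_plane:
  fixes a b :: real
  assumes "a \<noteq> 0 \<or> b \<noteq> 0"
  obtains r \<theta> where "r \<noteq> 0" "\<theta> \<in> {0..<pi}" "sin \<theta> = r * a" "- cos \<theta> = r * b"
proof -
  define s where "s = sqrt (a\<^sup>2 + b\<^sup>2)"
  have s: "s > 0" "s\<^sup>2 = a\<^sup>2 + b\<^sup>2"
    using assms by (auto simp: s_def sum_power2_gt_zero_iff)
  have "(- b / s)\<^sup>2 + (a / s)\<^sup>2 = 1"
    using s assms by (simp add: power_divide add.commute flip: add_divide_distrib)
  then obtain t where t: "0 \<le> t" "t < 2 * pi" "- b / s = cos t" "a / s = sin t"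
    using sincos_total_2pi by metis
  show thesis
  proof (cases "t < pi")
    case True
    with t s show thesis by (intro that[of "1 / s" t]) auto
  next
    case False
    have "sin (t - pi) = - sin t" "cos (t - pi) = - cos t"
      by (simp_all add: sin_diff cos_diff)
    with t s False show thesis by (intro that[of "- 1 / s" "t - pi"]) (auto simp flip: t(3,4))
  qed
qed

text \<open>Here \<open>q L a b\<close> stands for the norm on \<open>[0, L]\<close> of \<open>a\<close> times the solution with initial data \<open>(1, 0)\<close>
  plus \<open>b\<close> times the one with initial data \<open>(0, 1)\<close>. The factor 2 in the triangle inequality is
  harmless for the argument and spares Minkowski's inequality.\<close>

locale solution_norms =
  fixes q :: "real \<Rightarrow> real \<Rightarrow> real \<Rightarrow> real"
  assumes nonneg: "0 \<le> q L a b"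
    and add: "q L (a + c) (b + d) \<le> 2 * (q L a b + q L c d)"
    and scale: "q L (r * a) (r * b) = \<bar>r\<bar> * q L a b"
    and mono: "0 \<le> L \<Longrightarrow> L \<le> M \<Longrightarrow> q L a b \<le> q M a b"
    and pos: "a \<noteq> 0 \<or> b \<noteq> 0 \<Longrightarrow> \<exists>L\<ge>0. 0 < q L a b"
begin

text \<open>Stands for square-integrability of the solution; the two are identified in
  \<open>L2_c_iff_bounded\<close> and \<open>L2_d_iff_bounded\<close>.\<close>

definition bd :: "real \<Rightarrow> real \<Rightarrow> bool" where
  "bd a b \<longleftrightarrow> (\<exists>C. \<forall>L\<ge>0. q L a b \<le> C)"

definition sub :: "real \<Rightarrow> bool" where
  "sub \<theta> \<longleftrightarrow> ((\<lambda>L. q L (sin \<theta>) (- cos \<theta>) / q L (sin (\<theta> - pi / 2)) (- cos (\<theta> - pi / 2))) \<longlongrightarrow> 0) at_top"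

text \<open>Monotonicity preserves a norm that is positive once. The bound keeps denominators
  positive when the quotient in \<open>sub\<close> is multiplied out, and later contradicts norms
  that are too small.\<close>

lemma eventually_ge:
  assumes "a \<noteq> 0 \<or> b \<noteq> 0"
  obtains m where "m > 0" "eventually (\<lambda>L. m \<le> q L a b) at_top"
proof -
  obtain L0 where L0: "L0 \<ge> 0" "0 < q L0 a b" using pos[OF assms] by blast
  have "eventually (\<lambda>L. q L0 a b \<le> q L a b) at_top"
    using eventually_ge_at_top[of L0] by eventually_elim (use L0 mono in auto)
  with L0 that show thesis by blast
qed

text \<open>Cramer's rule: \<open>s\<close> and \<open>t\<close> are the coordinates of
  \<open>(c, d)\<close> in the basis \<open>(a, b)\<close>, \<open>(a', b')\<close> with determinant
  \<open>D\<close>. They do not involve \<open>L\<close>, hence the uniform constant.\<close>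

lemma le_independent:
  assumes "a * b' - b * a' \<noteq> 0"
  obtains K where "K \<ge> 0" "\<And>L. q L c d \<le> K * (q L a b + q L a' b')"
proof -
  define D where "D = a * b' - b * a'"
  define s where "s = (c * b' - d * a') / D"
  define t where "t = (a * d - b * c) / D"
  have D: "D \<noteq> 0" using assms by (simp add: D_def)
  have "(s * a + t * a') * D = c * D" "(s * b + t * b') * D = d * D"
    using D by (simp_all add: s_def t_def field_simps) (simp_all add: D_def algebra_simps)
  with D have cd: "s * a + t * a' = c" "s * b + t * b' = d" by simp_all
  have "q L c d \<le> 2 * (\<bar>s\<bar> + \<bar>t\<bar>) * (q L a b + q L a' b')" for L
  proof -
    have "q L c d \<le> 2 * (\<bar>s\<bar> * q L a b + \<bar>t\<bar> * q L a' b')"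
      using add[of L "s * a" "t * a'" "s * b" "t * b'"] by (simp add: cd scale)
    also have "\<dots> \<le> 2 * (\<bar>s\<bar> + \<bar>t\<bar>) * (q L a b + q L a' b')"
      using nonneg[of L a b] nonneg[of L a' b'] by (simp add: algebra_simps)
    finally show ?thesis .
  qed
  then show thesis by (intro that[of "2 * (\<bar>s\<bar> + \<bar>t\<bar>)"]) auto
qed

lemma sub_small:
  assumes "sub \<theta>" "e > 0"
  shows "eventually (\<lambda>L. q L (sin \<theta>) (- cos \<theta>) \<le> e * q L (sin (\<theta> - pi / 2)) (- cos (\<theta> - pi / 2))) at_top"
proof -
  obtain m where m: "m > 0" "eventually (\<lambda>L. m \<le> q L (sin (\<theta> - pi / 2)) (- cos (\<theta> - pi / 2))) at_top"
    using eventually_ge[OF sin_cos_nonzero] .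
  have "eventually (\<lambda>L. q L (sin \<theta>) (- cos \<theta>) / q L (sin (\<theta> - pi / 2)) (- cos (\<theta> - pi / 2)) < e) at_top"
    using assms unfolding sub_def by (rule order_tendstoD)
  with m(2) show ?thesis
  proof eventually_elim
    case (elim L)
    with m(1) show ?case by (simp add: divide_less_eq split: if_splits)
  qed
qed

text \<open>Two subordinate angles would give independent solutions whose norms, with sum
  \<open>S L\<close>, dominate every other solution. Each of the two is also negligible against its
  own partner at angle minus \<open>pi / 2\<close>, hence against \<open>S L\<close>, so
  \<open>S L\<close> would be at most half of itself.\<close>

lemma sub_unique:
  assumes "\<theta> \<in> {0..<pi}" "sub \<theta>" "\<eta> \<in> {0..<pi}" "sub \<eta>"
  shows "\<theta> = \<eta>"
proof (rule ccontr)
  assume ne: "\<theta> \<noteq> \<eta>"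
  \<comment> \<open>This sine is the determinant of the two data vectors; both angles lie in a
    half-open interval of length \<open>pi\<close>.\<close>
  have "sin (\<eta> - \<theta>) \<noteq> 0"
  proof (cases "\<eta> > \<theta>")
    case True
    with assms sin_gt_zero[of "\<eta> - \<theta>"] show ?thesis by auto
  next
    case False
    with assms ne sin_gt_zero[of "\<theta> - \<eta>"] have "sin (\<theta> - \<eta>) > 0" by auto
    then show ?thesis using sin_minus[of "\<theta> - \<eta>"] by simp
  qed
  then have D: "sin \<theta> * (- cos \<eta>) - (- cos \<theta>) * sin \<eta> \<noteq> 0"
    by (simp add: sin_diff mult.commute)
  define S where "S L = q L (sin \<theta>) (- cos \<theta>) + q L (sin \<eta>) (- cos \<eta>)" for L
  obtain K1 where K1: "K1 \<ge> 0" "\<And>L. q L (sin (\<theta> - pi / 2)) (- cos (\<theta> - pi / 2)) \<le> K1 * S L"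
    unfolding S_def by (rule le_independent[OF D]) auto
  obtain K2 where K2: "K2 \<ge> 0" "\<And>L. q L (sin (\<eta> - pi / 2)) (- cos (\<eta> - pi / 2)) \<le> K2 * S L"
    unfolding S_def by (rule le_independent[OF D]) auto
  \<comment> \<open>Makes the total factor \<open>e * (K1 + K2)\<close> at most 1/2; the summand 1
    keeps the denominator positive.\<close>
  define e where "e = 1 / (2 * (K1 + K2 + 1))"
  have e: "e > 0" "e * (K1 + K2) \<le> 1/2" using K1 K2 by (auto simp: e_def field_simps)
  obtain m where m: "m > 0" "eventually (\<lambda>L. m \<le> q L (sin \<theta>) (- cos \<theta>)) at_top"
    using eventually_ge[OF sin_cos_nonzero] .
  from sub_small[OF assms(2) e(1)] sub_small[OF assms(4) e(1)] m(2)
  have "eventually (\<lambda>L::real. False) at_top"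
  proof eventually_elim
    case (elim L)
    have "S L > 0" using elim(3) m(1) nonneg[of L "sin \<eta>" "- cos \<eta>"] by (simp add: S_def)
    have "S L \<le> e * (K1 * S L) + e * (K2 * S L)"
      using elim(1,2) mult_left_mono[OF K1(2)[of L], of e] mult_left_mono[OF K2(2)[of L], of e] e(1)
      unfolding S_def by linarith
    also have "\<dots> = e * (K1 + K2) * S L" by (simp add: algebra_simps)
    also have "\<dots> \<le> 1/2 * S L" using e(2) \<open>S L > 0\<close> by (intro mult_right_mono) auto
    finally show ?case using \<open>S L > 0\<close> by simp
  qed
  then show False by simp
qed

lemma the_sub:
  assumes "\<theta> \<in> {0..<pi}" "sub \<theta>"
  shows "(THE \<theta>. \<theta> \<in> {0..<pi} \<and> sub \<theta>) = \<theta>"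
  using assms sub_unique by (intro the_equality) blast+

lemma bd_independent:
  assumes "a * b' - b * a' \<noteq> 0" "bd a b" "bd a' b'"
  shows "bd c d"
proof -
  obtain K where K: "K \<ge> 0" "\<And>L. q L c d \<le> K * (q L a b + q L a' b')"
    by (rule le_independent[OF assms(1)]) auto
  obtain C C' where C: "\<forall>L\<ge>0. q L a b \<le> C" "\<forall>L\<ge>0. q L a' b' \<le> C'"
    using assms unfolding bd_def by blast
  have "q L c d \<le> K * (C + C')" if "L \<ge> 0" for L
    using K(2)[of L] mult_left_mono[of "q L a b + q L a' b'" "C + C'" K] C K(1) that
    by (meson add_mono order_trans)
  then show ?thesis unfolding bd_def by blast
qed

text \<open>From right to left, the bounded solution is rescaled to an angle. Its partner at angle
  minus \<open>pi / 2\<close> cannot be bounded as well, since then all solutions would be; being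
  monotone in \<open>L\<close>, the partner's norm tends to infinity, and bounded over infinite
  tends to 0.\<close>

lemma sub_bd_iff:
  "(\<exists>\<theta>\<in>{0..<pi}. sub \<theta>) \<and>
     bd (sin (THE \<theta>. \<theta> \<in> {0..<pi} \<and> sub \<theta>)) (- cos (THE \<theta>. \<theta> \<in> {0..<pi} \<and> sub \<theta>)) \<longleftrightarrow>
   (\<exists>a b. (a \<noteq> 0 \<or> b \<noteq> 0) \<and> bd a b) \<and> (\<exists>a b. \<not> bd a b)"
proof (intro iffI; elim conjE exE bexE)
  fix \<theta>
  assume th: "\<theta> \<in> {0..<pi}" "sub \<theta>"
    and bdT: "bd (sin (THE \<theta>. \<theta> \<in> {0..<pi} \<and> sub \<theta>)) (- cos (THE \<theta>. \<theta> \<in> {0..<pi} \<and> sub \<theta>))"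
  have bd1: "bd (sin \<theta>) (- cos \<theta>)" using bdT by (simp only: the_sub[OF th])
  have "\<not> bd (sin (\<theta> - pi / 2)) (- cos (\<theta> - pi / 2))"
  proof
    assume "bd (sin (\<theta> - pi / 2)) (- cos (\<theta> - pi / 2))"
    then obtain C where C: "\<forall>L\<ge>0. q L (sin (\<theta> - pi / 2)) (- cos (\<theta> - pi / 2)) \<le> C"
      unfolding bd_def by blast
    obtain m where m: "m > 0" "eventually (\<lambda>L. m \<le> q L (sin \<theta>) (- cos \<theta>)) at_top"
      using eventually_ge[OF sin_cos_nonzero] .
    \<comment> \<open>If the partner were bounded by \<open>C\<close>, the numerator would
      eventually be at most \<open>e * C\<close>, which this choice places at or below
      \<open>m / 2\<close>, against the lower bound \<open>m\<close>.\<close>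
    define e where "e = m / (2 * (\<bar>C\<bar> + 1))"
    have e: "e > 0" using m by (simp add: e_def)
    from sub_small[OF th(2) e] m(2) eventually_ge_at_top[of 0]
    have "eventually (\<lambda>L::real. False) at_top"
    proof eventually_elim
      case (elim L)
      then have "m \<le> e * C" using C mult_left_mono[of _ C e] e by (meson order_trans less_imp_le)
      also have "\<dots> \<le> e * (\<bar>C\<bar> + 1)" using e by (intro mult_left_mono) auto
      also have "e * (\<bar>C\<bar> + 1) = m / 2"
      proof -
        have "\<bar>C\<bar> + 1 \<noteq> 0" by linarith
        then show ?thesis by (simp only: e_def) (simp add: divide_simps)
      qed
      finally show ?case using m by simp
    qed
    then show False by simp
  qed
  with bd1 sin_cos_nonzero
  show "(\<exists>a b. (a \<noteq> 0 \<or> b \<noteq> 0) \<and> bd a b) \<and> (\<exists>a b. \<not> bd a b)" by blast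
next
  fix a b c d
  assume ab: "a \<noteq> 0 \<or> b \<noteq> 0" "bd a b" and cd: "\<not> bd c d"
  obtain r \<theta> where r: "r \<noteq> 0" "\<theta> \<in> {0..<pi}" "sin \<theta> = r * a" "- cos \<theta> = r * b"
    using polar_half_plane[OF ab(1)] .
  obtain C where C: "\<forall>L\<ge>0. q L a b \<le> C" using ab(2) unfolding bd_def by blast
  have qb: "q L (sin \<theta>) (- cos \<theta>) \<le> \<bar>r\<bar> * C" if "L \<ge> 0" for L
    unfolding r scale using C that by (intro mult_left_mono) auto
  then have bd1: "bd (sin \<theta>) (- cos \<theta>)" unfolding bd_def by blast
  \<comment> \<open>The determinant is -1: subtracting \<open>pi / 2\<close> rotates the data vector
    by a right angle.\<close>
  have "sin \<theta> * (- cos (\<theta> - pi / 2)) - (- cos \<theta>) * sin (\<theta> - pi / 2) \<noteq> 0"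
    using sin_cos_squared_add[of \<theta>] by (simp add: sin_diff cos_diff power2_eq_square)
  then have nbd: "\<not> bd (sin (\<theta> - pi / 2)) (- cos (\<theta> - pi / 2))"
    using bd_independent bd1 cd by blast
  have top: "filterlim (\<lambda>L. q L (sin (\<theta> - pi / 2)) (- cos (\<theta> - pi / 2))) at_top at_top"
    unfolding filterlim_at_top
  proof
    fix Z
    obtain L0 where L0: "L0 \<ge> 0" "q L0 (sin (\<theta> - pi / 2)) (- cos (\<theta> - pi / 2)) > Z"
      using nbd unfolding bd_def by (meson not_le)
    show "eventually (\<lambda>L. Z \<le> q L (sin (\<theta> - pi / 2)) (- cos (\<theta> - pi / 2))) at_top"
      using eventually_ge_at_top[of L0]
    proof eventually_elim
      case (elim L)
      then show ?case using L0 mono[of L0 L] by (meson less_imp_le order_trans)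
    qed
  qed
  have "((\<lambda>L. \<bar>r\<bar> * C / q L (sin (\<theta> - pi / 2)) (- cos (\<theta> - pi / 2))) \<longlongrightarrow> 0) at_top"
    by (rule real_tendsto_divide_at_top[OF tendsto_const top])
  then have "sub \<theta>" unfolding sub_def
  proof (rule tendsto_sandwich[rotated 3])
    show "((\<lambda>L. 0) \<longlongrightarrow> (0::real)) at_top" by simp
    show "eventually (\<lambda>L. 0 \<le> q L (sin \<theta>) (- cos \<theta>) / q L (sin (\<theta> - pi / 2)) (- cos (\<theta> - pi / 2))) at_top"
      by (simp add: nonneg)
    show "eventually (\<lambda>L. q L (sin \<theta>) (- cos \<theta>) / q L (sin (\<theta> - pi / 2)) (- cos (\<theta> - pi / 2))
        \<le> \<bar>r\<bar> * C / q L (sin (\<theta> - pi / 2)) (- cos (\<theta> - pi / 2))) at_top"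
      using eventually_ge_at_top[of 0] by eventually_elim (intro divide_right_mono qb nonneg)
  qed
  with r(2) bd1 the_sub[OF r(2)]
  show "(\<exists>\<theta>\<in>{0..<pi}. sub \<theta>) \<and>
     bd (sin (THE \<theta>. \<theta> \<in> {0..<pi} \<and> sub \<theta>)) (- cos (THE \<theta>. \<theta> \<in> {0..<pi} \<and> sub \<theta>))"
    by metis
qed

end

section \<open>The continuum case\<close>

lemma absolutely_integrable_continuous_mult:
  fixes g h :: "real \<Rightarrow> real"
  assumes "continuous_on {a..b} g" "h absolutely_integrable_on {a..b}"
  shows "(\<lambda>x. h x * g x) absolutely_integrable_on {a..b}"
proof -
  have "(\<lambda>x. g x * h x) absolutely_integrable_on {a..b}"
    using assms
    by (intro absolutely_integrable_bounded_measurable_product_real)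
       (auto intro!: continuous_imp_measurable_on_sets_lebesgue compact_imp_bounded compact_continuous_image)
  then show ?thesis by (simp add: mult.commute)
qed

text \<open>Since \<open>F\<close> is only an indefinite integral, the pointwise product rule may
  fail on a null set. The defect \<open>D\<close> between the product and the integral of its formal
  derivative is shown to have derivative 0 at every point: its increments are bounded by
  \<open>y - x\<close> times the increment of the continuous function \<open>H\<close>, which
  controls the variation of \<open>F\<close>.\<close>

lemma has_integral_product_indefinite:
  fixes h g g' F :: "real \<Rightarrow> real"
  assumes "0 \<le> b"
    and h: "h absolutely_integrable_on {0..b}"
    and F: "\<And>x. x \<in> {0..b} \<Longrightarrow> F x = F 0 + integral {0..x} h"
    and g: "\<And>x. x \<in> {0..b} \<Longrightarrow> (g has_real_derivative g' x) (at x within {0..b})"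
    and g': "continuous_on {0..b} g'"
  shows "((\<lambda>x. h x * g x + F x * g' x) has_integral F b * g b - F 0 * g 0) {0..b}"
proof -
  define k where "k x = h x * g x + F x * g' x" for x
  define H where "H x = integral {0..x} (\<lambda>t. \<bar>h t\<bar>)" for x
  define D where "D x = F x * g x - integral {0..x} k" for x
  have hint: "h integrable_on {0..b}" and habs: "(\<lambda>t. \<bar>h t\<bar>) integrable_on {0..b}"
    using h unfolding absolutely_integrable_on_def by simp_all
  have contg: "continuous_on {0..b} g"
    using g by (meson DERIV_continuous continuous_on_eq_continuous_within)
  have contH: "continuous_on {0..b} H"
    unfolding H_def by (rule indefinite_integral_continuous_1[OF habs])
  have "continuous_on {0..b} (\<lambda>x. F 0 + integral {0..x} h)"
    by (intro continuous_intros indefinite_integral_continuous_1[OF hint])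
  then have contF: "continuous_on {0..b} F" using F by (subst continuous_on_cong[OF refl F])
  have kint: "k integrable_on {0..b}"
    unfolding k_def
  proof (rule integrable_add)
    show "(\<lambda>x. h x * g x) integrable_on {0..b}"
      using absolutely_integrable_continuous_mult[OF contg h] by (simp add: absolutely_integrable_on_def)
  qed (intro integrable_continuous_interval continuous_intros contF g')
  obtain G where G: "G > 0" "\<And>x. x \<in> {0..b} \<Longrightarrow> \<bar>g' x\<bar> \<le> G"
    using compact_imp_bounded[OF compact_continuous_image[OF g' compact_Icc]]
    unfolding bounded_pos by auto
  have lip: "\<bar>g y - g t\<bar> \<le> G * (y - t)" if "t \<in> {0..b}" "y \<in> {0..b}" "t \<le> y" for t y
  proof -
    have "norm (g t - g y) \<le> G * norm (t - y)"
      by (rule field_differentiable_bound[OF convex_real_interval(5) g]) (use G that in auto)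
    then show ?thesis using that by (simp add: abs_minus_commute)
  qed
  have sub: "f integrable_on {x..y}" if "f integrable_on {0..b}" "0 \<le> x" "y \<le> b" for f :: "real \<Rightarrow> real" and x y
    using that by (auto intro: integrable_on_subinterval)
  have diff: "integral {0..y} f - integral {0..x} f = integral {x..y} f"
    if "f integrable_on {0..b}" "0 \<le> x" "x \<le> y" "y \<le> b" for f :: "real \<Rightarrow> real" and x y
    using Henstock_Kurzweil_Integration.integral_combine[of 0 x y f] sub[OF that(1), of 0 y] that by simp
  have est: "\<bar>D y - D x\<bar> \<le> 2 * G * (y - x) * (H y - H x)" if xy: "0 \<le> x" "x \<le> y" "y \<le> b" for x y
  proof -
    \<comment> \<open>With \<open>g\<close> frozen at \<open>y\<close> and \<open>F\<close> frozen
      at \<open>x\<close>, the first two terms integrate exactly to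
      \<open>F y * g y - F x * g x\<close>, so \<open>e\<close> integrates to the increment of
      \<open>D\<close>. Pointwise, \<open>e\<close> contains only the small differences
      \<open>g y - g t\<close> and \<open>F x - F t\<close>.\<close>
    define e where "e t = h t * g y + F x * g' t - k t" for t
    have g'int: "(g' has_integral g y - g x) {x..y}"
      using xy by (intro fundamental_theorem_of_calculus)
        (auto intro!: has_field_derivative_subset[OF g] simp flip: has_real_derivative_iff_has_vector_derivative)
    have "(h has_integral F y - F x) {x..y}"
      using diff[OF hint xy] F[of x] F[of y] xy sub[OF hint, of x y] by (auto simp: has_integral_iff)
    then have eint: "(e has_integral (F y - F x) * g y + F x * (g y - g x) - (integral {0..y} k - integral {0..x} k)) {x..y}"
      unfolding e_def diff[OF kint xy] using xy sub[OF kint, of x y]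
      by (intro has_integral_diff has_integral_add has_integral_mult_left has_integral_mult_right g'int)
         (auto simp: has_integral_iff)
    also have "(F y - F x) * g y + F x * (g y - g x) - (integral {0..y} k - integral {0..x} k) = D y - D x"
      by (simp add: D_def algebra_simps)
    finally have eint: "(e has_integral D y - D x) {x..y}" .
    have bint: "((\<lambda>t. \<bar>h t\<bar> * (G * (y - x)) + (H y - H x) * G) has_integral
        (H y - H x) * (G * (y - x)) + (y - x) * ((H y - H x) * G)) {x..y}"
      using diff[OF habs xy] sub[OF habs, of x y] xy has_integral_const_real[of "(H y - H x) * G" x y]
      by (intro has_integral_add has_integral_mult_left) (auto simp: has_integral_iff H_def)
    have le: "\<bar>e t\<bar> \<le> \<bar>h t\<bar> * (G * (y - x)) + (H y - H x) * G" if t: "t \<in> {x..y}" for t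
    proof -
      have t': "0 \<le> t" "t \<le> b" "x \<le> t" "t \<le> y" using t xy by auto
      have "\<bar>F x - F t\<bar> = \<bar>integral {x..t} h\<bar>"
        using diff[OF hint, of x t] F[of x] F[of t] t' xy by auto
      also have "\<dots> \<le> integral {x..t} (\<lambda>t. \<bar>h t\<bar>)"
        using integral_norm_bound_integral[of h "{x..t}" "\<lambda>t. \<bar>h t\<bar>"] sub[OF hint, of x t] sub[OF habs, of x t] t' xy
        by auto
      also have "\<dots> \<le> integral {x..y} (\<lambda>t. \<bar>h t\<bar>)"
        using t' xy by (intro integral_subset_le sub[OF habs]) auto
      also have "\<dots> = H y - H x" using diff[OF habs xy] by (simp add: H_def)
      finally have 1: "\<bar>F x - F t\<bar> \<le> H y - H x" .
      have "\<bar>g y - g t\<bar> \<le> G * (y - t)" using t' xy by (intro lip) auto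
      also have "\<dots> \<le> G * (y - x)" using t' G by (intro mult_left_mono) auto
      finally have 2: "\<bar>g y - g t\<bar> \<le> G * (y - x)" .
      have 3: "\<bar>g' t\<bar> \<le> G" using G t' by auto
      have "e t = h t * (g y - g t) + (F x - F t) * g' t" by (simp add: e_def k_def algebra_simps)
      also have "\<bar>\<dots>\<bar> \<le> \<bar>h t\<bar> * \<bar>g y - g t\<bar> + \<bar>F x - F t\<bar> * \<bar>g' t\<bar>"
        by (metis abs_triangle_ineq abs_mult)
      also have "\<dots> \<le> \<bar>h t\<bar> * (G * (y - x)) + (H y - H x) * G"
        using 1 2 3 by (intro add_mono mult_left_mono mult_mono) auto
      finally show ?thesis .
    qed
    have "\<bar>D y - D x\<bar> \<le> (H y - H x) * (G * (y - x)) + (y - x) * ((H y - H x) * G)"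
      using integral_norm_bound_integral[of e "{x..y}" "\<lambda>t. \<bar>h t\<bar> * (G * (y - x)) + (H y - H x) * G"] le eint bint
      by (auto simp: has_integral_iff)
    then show ?thesis by (simp add: algebra_simps)
  qed
  \<comment> \<open>The increments of \<open>D\<close> are of order \<open>o(y - x)\<close>, so no differentiability of \<open>F\<close> is needed.\<close>
  have "(D has_real_derivative 0) (at x within {0..b})" if x: "x \<in> {0..b}" for x
    unfolding has_field_derivative_iff
  proof (rule Lim_null_comparison)
    have "(H \<longlongrightarrow> H x) (at x within {0..b})"
      using contH x by (auto simp: continuous_on)
    then have "((\<lambda>y. 2 * G * \<bar>H y - H x\<bar>) \<longlongrightarrow> 2 * G * \<bar>H x - H x\<bar>) (at x within {0..b})"
      by (intro tendsto_intros)
    then show "((\<lambda>y. 2 * G * \<bar>H y - H x\<bar>) \<longlongrightarrow> 0) (at x within {0..b})" by simp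
    have "norm ((D y - D x) / (y - x)) \<le> 2 * G * \<bar>H y - H x\<bar>" if y: "y \<in> {0..b}" "y \<noteq> x" for y
    proof -
      have "\<bar>D y - D x\<bar> \<le> 2 * G * \<bar>H y - H x\<bar> * \<bar>y - x\<bar>"
      proof (cases "x \<le> y")
        case True
        have "\<bar>D y - D x\<bar> \<le> 2 * G * (y - x) * (H y - H x)" using est[of x y] x y True by auto
        also have "\<dots> \<le> 2 * G * (y - x) * \<bar>H y - H x\<bar>" using G True by (intro mult_left_mono) auto
        finally show ?thesis using True by (simp add: algebra_simps)
      next
        case False
        have "\<bar>D x - D y\<bar> \<le> 2 * G * (x - y) * (H x - H y)" using est[of y x] x y False by auto
        also have "\<dots> \<le> 2 * G * (x - y) * \<bar>H y - H x\<bar>" using G False by (intro mult_left_mono) auto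
        finally show ?thesis using False by (simp add: algebra_simps abs_minus_commute)
      qed
      then show ?thesis using y by (simp add: field_simps)
    qed
    then show "eventually (\<lambda>y. norm ((D y - D x) / (y - x)) \<le> 2 * G * \<bar>H y - H x\<bar>) (at x within {0..b})"
      by (auto simp: eventually_at_filter)
  qed
  then obtain c where "\<And>x. x \<in> {0..b} \<Longrightarrow> D x = c"
    using has_field_derivative_zero_constant[OF convex_real_interval(5)] by blast
  then have "D b = D 0" using \<open>0 \<le> b\<close> by auto
  then have "integral {0..b} k = F b * g b - F 0 * g 0" by (simp add: D_def)
  then show ?thesis using kint unfolding k_def by (simp add: has_integral_iff)
qed

text \<open>A class closed under sums that contains the bounded and the globally integrable potentials; the
  constant \<open>K\<close> does not depend on \<open>B\<close>, so the Volterra operator becomes a contraction in the norm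
  with weight \<open>exp (- B x)\<close> for large \<open>B\<close>.\<close>

definition tame :: "(real \<Rightarrow> real) \<Rightarrow> bool" where
  "tame V \<longleftrightarrow> potential_c V \<and>
     (\<exists>K\<ge>0. \<forall>B\<ge>1. \<forall>t\<ge>0. integral {0..t} (\<lambda>s. \<bar>V s\<bar> * exp (B * s)) \<le> K * exp (B * t))"

lemma potential_c_continuous_mult:
  assumes "potential_c V" "continuous_on {0..} g" "0 \<le> t"
  shows "(\<lambda>s. V s * g s) absolutely_integrable_on {0..t}"
  using assms unfolding potential_c_def
  by (intro absolutely_integrable_continuous_mult) (auto elim: continuous_on_subset)

lemma potential_c_abs: "potential_c V \<Longrightarrow> potential_c (\<lambda>x. \<bar>V x\<bar>)"
  by (auto simp: potential_c_def absolutely_integrable_on_def)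

lemma potential_c_add: "potential_c V \<Longrightarrow> potential_c U \<Longrightarrow> potential_c (\<lambda>x. V x + U x)"
  unfolding potential_c_def by auto

lemma potential_c_weight_integrable:
  assumes "potential_c V" "0 \<le> t"
  shows "(\<lambda>s. \<bar>V s\<bar> * exp (B * s)) integrable_on {0..t}"
proof -
  have "continuous_on {0..} (\<lambda>s. exp (B * s))" by (intro continuous_intros)
  from potential_c_continuous_mult[OF potential_c_abs[OF assms(1)] this assms(2)]
  show ?thesis by (simp add: absolutely_integrable_on_def)
qed

lemma tameE:
  assumes "tame V"
  obtains K where "K \<ge> 0"
    "\<And>B t. B \<ge> 1 \<Longrightarrow> t \<ge> 0 \<Longrightarrow> integral {0..t} (\<lambda>s. \<bar>V s\<bar> * exp (B * s)) \<le> K * exp (B * t)"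
  using assms unfolding tame_def by blast

lemma tame_add:
  assumes "tame V" "tame U"
  shows "tame (\<lambda>x. V x + U x)"
proof -
  obtain K1 where K1: "K1 \<ge> 0"
    "\<And>B t. B \<ge> 1 \<Longrightarrow> t \<ge> 0 \<Longrightarrow> integral {0..t} (\<lambda>s. \<bar>V s\<bar> * exp (B * s)) \<le> K1 * exp (B * t)"
    using tameE[OF assms(1)] by blast
  obtain K2 where K2: "K2 \<ge> 0"
    "\<And>B t. B \<ge> 1 \<Longrightarrow> t \<ge> 0 \<Longrightarrow> integral {0..t} (\<lambda>s. \<bar>U s\<bar> * exp (B * s)) \<le> K2 * exp (B * t)"
    using tameE[OF assms(2)] by blast
  have p: "potential_c V" "potential_c U" using assms by (auto simp: tame_def)
  have pa: "potential_c (\<lambda>x. V x + U x)" using p by (rule potential_c_add)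
  have "integral {0..t} (\<lambda>s. \<bar>V s + U s\<bar> * exp (B * s)) \<le> (K1 + K2) * exp (B * t)"
    if Bt: "B \<ge> 1" "t \<ge> 0" for B t
  proof -
    note int = potential_c_weight_integrable[OF _ \<open>t \<ge> 0\<close>, of _ B]
    have "integral {0..t} (\<lambda>s. \<bar>V s + U s\<bar> * exp (B * s))
      \<le> integral {0..t} (\<lambda>s. \<bar>V s\<bar> * exp (B * s) + \<bar>U s\<bar> * exp (B * s))"
      by (intro integral_le integrable_add int p pa) (simp flip: distrib_right)
    also have "\<dots> \<le> K1 * exp (B * t) + K2 * exp (B * t)"
      using K1(2)[OF Bt] K2(2)[OF Bt] by (subst integral_add) (auto intro: int p)
    finally show ?thesis by (simp add: distrib_right)
  qed
  with K1(1) K2(1) pa show ?thesis unfolding tame_def by (intro conjI exI[of _ "K1 + K2"]) auto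
qed

text \<open>Integrating the exponential yields a factor \<open>1 / B\<close>, which
  \<open>B \<ge> 1\<close> allows to drop; changing \<open>V\<close> to 0 on a null set makes the
  essential bound pointwise.\<close>

lemma tame_bounded:
  assumes "potential_c V" "bounded_c V"
  shows "tame V"
proof -
  obtain C where "AE x in lebesgue. x \<ge> 0 \<longrightarrow> \<bar>V x\<bar> \<le> C"
    using assms unfolding bounded_c_def by blast
  then obtain N where N: "negligible N" "\<And>x. x \<notin> N \<Longrightarrow> x \<ge> 0 \<Longrightarrow> \<bar>V x\<bar> \<le> C"
    unfolding completion.AE_iff_null_sets negligible_iff_null_sets by auto
  have "integral {0..t} (\<lambda>s. \<bar>V s\<bar> * exp (B * s)) \<le> \<bar>C\<bar> * exp (B * t)"
    if Bt: "B \<ge> 1" "t \<ge> 0" for B t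
  proof -
    have ex: "((\<lambda>s. \<bar>C\<bar> * exp (B * s)) has_integral (\<bar>C\<bar> * exp (B * t) / B - \<bar>C\<bar> * exp (B * 0) / B)) {0..t}"
      using Bt by (intro fundamental_theorem_of_calculus)
        (auto intro!: derivative_eq_intros simp flip: has_real_derivative_iff_has_vector_derivative)
    have "integral {0..t} (\<lambda>s. \<bar>V s\<bar> * exp (B * s)) =
          integral {0..t} (\<lambda>s. if s \<in> N then 0 else \<bar>V s\<bar> * exp (B * s))"
      by (rule integral_spike[OF N(1)]) auto
    also have "\<dots> \<le> integral {0..t} (\<lambda>s. \<bar>C\<bar> * exp (B * s))"
    proof (rule integral_le)
      show "(\<lambda>s. if s \<in> N then 0 else \<bar>V s\<bar> * exp (B * s)) integrable_on {0..t}"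
        by (rule integrable_spike[OF potential_c_weight_integrable[OF assms(1) Bt(2)] N(1)]) auto
      show "(\<lambda>s. \<bar>C\<bar> * exp (B * s)) integrable_on {0..t}" using ex by blast
    next
      fix s assume "s \<in> {0..t}"
      then show "(if s \<in> N then 0 else \<bar>V s\<bar> * exp (B * s)) \<le> \<bar>C\<bar> * exp (B * s)"
        using N(2)[of s] by auto
    qed
    also have "\<dots> = (\<bar>C\<bar> * exp (B * t) - \<bar>C\<bar>) / B"
      using ex by (simp add: has_integral_iff diff_divide_distrib)
    also have "\<dots> \<le> (\<bar>C\<bar> * exp (B * t)) / 1" using Bt by (intro frac_le) auto
    finally show ?thesis by simp
  qed
  with assms(1) show ?thesis unfolding tame_def by (intro conjI exI[of _ "\<bar>C\<bar>"]) auto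
qed

text \<open>On \<open>{0..t}\<close> the weight is at most its value at \<open>t\<close>, so the
  total integral of \<open>\<bar>W x\<bar>\<close> serves as \<open>K\<close>.\<close>

lemma tame_integrable:
  assumes "potential_c W" "(\<lambda>x. \<bar>W x\<bar>) integrable_on {0..}"
  shows "tame W"
proof -
  have "integral {0..t} (\<lambda>s. \<bar>W s\<bar> * exp (B * s)) \<le> integral {0..} (\<lambda>x. \<bar>W x\<bar>) * exp (B * t)"
    if Bt: "B \<ge> 1" "t \<ge> 0" for B t
  proof -
    have int: "(\<lambda>x. \<bar>W x\<bar>) integrable_on {0..t}"
      using assms(1) Bt unfolding potential_c_def absolutely_integrable_on_def by auto
    have "integral {0..t} (\<lambda>s. \<bar>W s\<bar> * exp (B * s)) \<le> integral {0..t} (\<lambda>s. \<bar>W s\<bar> * exp (B * t))"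
      using Bt by (intro integral_le potential_c_weight_integrable assms) (auto intro!: integrable_on_mult_left int mult_left_mono)
    also have "\<dots> = integral {0..t} (\<lambda>s. \<bar>W s\<bar>) * exp (B * t)" by simp
    also have "\<dots> \<le> integral {0..} (\<lambda>s. \<bar>W s\<bar>) * exp (B * t)"
      by (intro mult_right_mono integral_subset_le int assms) auto
    finally show ?thesis .
  qed
  then show ?thesis using assms(1) integral_nonneg[OF assms(2)] unfolding tame_def by auto
qed

section \<open>Wronskians and existence of solutions with exponential bounds\<close>

lemma solves_cE:
  assumes "solves_c V lam u u'"
  obtains u'' where "\<And>x. x \<ge> 0 \<Longrightarrow> (u has_real_derivative u' x) (at x within {0..})"
    "\<And>b. b \<ge> 0 \<Longrightarrow> u'' absolutely_integrable_on {0..b}"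
    "\<And>x. x \<ge> 0 \<Longrightarrow> u' x = u' 0 + integral {0..x} u''"
    "AE x in lebesgue. x \<ge> 0 \<longrightarrow> u'' x = (V x - lam) * u x"
proof -
  obtain u'' where u'': "\<forall>x\<ge>0. (u has_real_derivative u' x) (at x within {0..})"
    "\<forall>b\<ge>0. u'' absolutely_integrable_on {0..b}"
    "\<forall>x\<ge>0. u' x = u' 0 + integral {0..x} u''"
    "AE x in lebesgue. x \<ge> 0 \<longrightarrow> - u'' x + V x * u x = lam * u x"
    using assms unfolding solves_c_def by blast
  have "AE x in lebesgue. x \<ge> 0 \<longrightarrow> u'' x = (V x - lam) * u x"
    using u''(4) by (rule eventually_mono) (auto simp: algebra_simps)
  with u''(1-3) show thesis by (intro that[of u'']) blast+
qed

lemma continuous_on_indefinite_integral_c: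
  fixes f :: "real \<Rightarrow> real"
  assumes "potential_c f"
  shows "continuous_on {0..} (\<lambda>x. integral {0..x} f)"
  unfolding continuous_on_eq_continuous_within
proof
  fix x :: real assume x: "x \<in> {0..}"
  then have "f integrable_on {0..x + 1}"
    using assms by (simp add: potential_c_def absolutely_integrable_on_def)
  then have "continuous_on {0..x + 1} (\<lambda>x. integral {0..x} f)"
    by (rule indefinite_integral_continuous_1)
  then have "continuous (at x within {0..x + 1}) (\<lambda>x. integral {0..x} f)"
    using x by (simp add: continuous_on_eq_continuous_within)
  moreover have "at x within {0..x + 1} = at x within {0..}"
    using x by (intro at_within_nhd[of x "{..<x + 1}"]) auto
  ultimately show "continuous (at x within {0..}) (\<lambda>x. integral {0..x} f)" by simp
qed

lemma solves_c_continuous: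
  assumes "solves_c V lam u u'"
  shows "continuous_on {0..} u" "continuous_on {0..} u'"
proof -
  obtain u'' where u'': "\<And>x. x \<ge> 0 \<Longrightarrow> (u has_real_derivative u' x) (at x within {0..})"
    "\<And>b. b \<ge> 0 \<Longrightarrow> u'' absolutely_integrable_on {0..b}"
    "\<And>x. x \<ge> 0 \<Longrightarrow> u' x = u' 0 + integral {0..x} u''"
    "AE x in lebesgue. x \<ge> 0 \<longrightarrow> u'' x = (V x - lam) * u x"
    using solves_cE[OF assms] by blast
  show "continuous_on {0..} u"
    unfolding continuous_on_eq_continuous_within using DERIV_continuous[OF u''(1)] by blast
  have "continuous_on {0..} (\<lambda>x. u' 0 + integral {0..x} u'')"
    using u''(2) by (intro continuous_intros continuous_on_indefinite_integral_c) (simp add: potential_c_def)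
  then show "continuous_on {0..} u'" by (rule continuous_on_eq) (metis u''(3) atLeast_iff)
qed

lemma solves_c_linear:
  assumes "solves_c V lam u u'" "solves_c V lam v v'"
  shows "solves_c V lam (\<lambda>x. a * u x + b * v x) (\<lambda>x. a * u' x + b * v' x)"
proof -
  obtain u'' where u'': "\<And>x. x \<ge> 0 \<Longrightarrow> (u has_real_derivative u' x) (at x within {0..})"
    "\<And>b. b \<ge> 0 \<Longrightarrow> u'' absolutely_integrable_on {0..b}"
    "\<And>x. x \<ge> 0 \<Longrightarrow> u' x = u' 0 + integral {0..x} u''"
    "AE x in lebesgue. x \<ge> 0 \<longrightarrow> u'' x = (V x - lam) * u x"
    using solves_cE[OF assms(1)] by blast
  obtain v'' where v'': "\<And>x. x \<ge> 0 \<Longrightarrow> (v has_real_derivative v' x) (at x within {0..})"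
    "\<And>b. b \<ge> 0 \<Longrightarrow> v'' absolutely_integrable_on {0..b}"
    "\<And>x. x \<ge> 0 \<Longrightarrow> v' x = v' 0 + integral {0..x} v''"
    "AE x in lebesgue. x \<ge> 0 \<longrightarrow> v'' x = (V x - lam) * v x"
    using solves_cE[OF assms(2)] by blast
  show ?thesis
    unfolding solves_c_def
  proof (intro conjI exI[of _ "\<lambda>x. a * u'' x + b * v'' x"] allI impI)
    fix x :: real assume x: "x \<ge> 0"
    show "((\<lambda>x. a * u x + b * v x) has_real_derivative a * u' x + b * v' x) (at x within {0..})"
      by (intro DERIV_add DERIV_cmult u'' v'' x)
    show "(\<lambda>x. a * u'' x + b * v'' x) absolutely_integrable_on {0..x}"
      using u''(2)[OF x] v''(2)[OF x] by auto
    have "integral {0..x} (\<lambda>x. a * u'' x + b * v'' x) = a * integral {0..x} u'' + b * integral {0..x} v''"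
      using u''(2)[OF x] v''(2)[OF x] by (subst integral_add) (auto simp: absolutely_integrable_on_def intro!: integrable_on_mult_right)
    then show "a * u' x + b * v' x = a * u' 0 + b * v' 0 + integral {0..x} (\<lambda>x. a * u'' x + b * v'' x)"
      by (simp add: u''(3)[OF x] v''(3)[OF x] algebra_simps)
  next
    show "AE x in lebesgue. 0 \<le> x \<longrightarrow> - (a * u'' x + b * v'' x) + V x * (a * u x + b * v x) = lam * (a * u x + b * v x)"
      using u''(4) v''(4)
    proof eventually_elim
      case (elim x)
      then show ?case by (intro impI) (simp, simp add: algebra_simps)
    qed
  qed
qed

text \<open>Integration by parts is applied to \<open>v' u\<close> and to \<open>u' v\<close>, each
  time with the derivative as the indefinite integral and the other solution as the differentiable
  factor. In the difference the terms \<open>u' v'\<close> and those with \<open>lam\<close> cancel;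
  the remaining identity holds off a null set, which the integral ignores.\<close>

lemma wronskian_c:
  assumes u: "solves_c V1 lam u u'" and v: "solves_c V2 lam v v'" and x: "x \<ge> 0"
  shows "((\<lambda>t. (V2 t - V1 t) * u t * v t) has_integral
           (u x * v' x - u' x * v x) - (u 0 * v' 0 - u' 0 * v 0)) {0..x}"
proof -
  obtain u'' where u'': "\<And>x. x \<ge> 0 \<Longrightarrow> (u has_real_derivative u' x) (at x within {0..})"
    "\<And>b. b \<ge> 0 \<Longrightarrow> u'' absolutely_integrable_on {0..b}"
    "\<And>x. x \<ge> 0 \<Longrightarrow> u' x = u' 0 + integral {0..x} u''"
    "AE x in lebesgue. x \<ge> 0 \<longrightarrow> u'' x = (V1 x - lam) * u x"
    using solves_cE[OF u] by blast
  obtain v'' where v'': "\<And>x. x \<ge> 0 \<Longrightarrow> (v has_real_derivative v' x) (at x within {0..})"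
    "\<And>b. b \<ge> 0 \<Longrightarrow> v'' absolutely_integrable_on {0..b}"
    "\<And>x. x \<ge> 0 \<Longrightarrow> v' x = v' 0 + integral {0..x} v''"
    "AE x in lebesgue. x \<ge> 0 \<longrightarrow> v'' x = (V2 x - lam) * v x"
    using solves_cE[OF v] by blast
  note cont = solves_c_continuous[OF u] solves_c_continuous[OF v]
  have 1: "((\<lambda>t. v'' t * u t + v' t * u' t) has_integral v' x * u x - v' 0 * u 0) {0..x}"
  proof (rule has_integral_product_indefinite[OF x v''(2)[OF x]])
    show "continuous_on {0..x} u'" by (rule continuous_on_subset[OF cont(2)]) auto
  next
    fix t assume "t \<in> {0..x}"
    then show "v' t = v' 0 + integral {0..t} v''" "(u has_real_derivative u' t) (at t within {0..x})"
      using v''(3)[of t] u''(1)[of t] by (auto elim!: has_field_derivative_subset)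
  qed
  have 2: "((\<lambda>t. u'' t * v t + u' t * v' t) has_integral u' x * v x - u' 0 * v 0) {0..x}"
  proof (rule has_integral_product_indefinite[OF x u''(2)[OF x]])
    show "continuous_on {0..x} v'" by (rule continuous_on_subset[OF cont(4)]) auto
  next
    fix t assume "t \<in> {0..x}"
    then show "u' t = u' 0 + integral {0..t} u''" "(v has_real_derivative v' t) (at t within {0..x})"
      using u''(3)[of t] v''(1)[of t] by (auto elim!: has_field_derivative_subset)
  qed
  have "AE t in lebesgue. t \<ge> 0 \<longrightarrow> (V2 t - V1 t) * u t * v t =
      (v'' t * u t + v' t * u' t) - (u'' t * v t + u' t * v' t)"
    using u''(4) v''(4) by eventually_elim (auto simp: left_diff_distrib right_diff_distrib)
  then obtain N where N: "negligible N" "\<And>t. t \<notin> N \<Longrightarrow> t \<ge> 0 \<Longrightarrow> (V2 t - V1 t) * u t * v t =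
      (v'' t * u t + v' t * u' t) - (u'' t * v t + u' t * v' t)"
    unfolding completion.AE_iff_null_sets negligible_iff_null_sets by auto
  have "((\<lambda>t. (V2 t - V1 t) * u t * v t) has_integral
           (v' x * u x - v' 0 * u 0) - (u' x * v x - u' 0 * v 0)) {0..x}"
    by (rule has_integral_spike[OF N(1) _ has_integral_diff[OF 1 2]]) (use N(2) in auto)
  then show ?thesis by (simp add: algebra_simps)
qed

lemma wronskian_const_c:
  assumes "solves_c V lam u u'" "solves_c V lam v v'" "x \<ge> 0"
  shows "u x * v' x - u' x * v x = u 0 * v' 0 - u' 0 * v 0"
proof -
  have "((\<lambda>t. 0) has_integral (u x * v' x - u' x * v x) - (u 0 * v' 0 - u' 0 * v 0)) {0..x}"
    using wronskian_c[OF assms] by simp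
  then show ?thesis using has_integral_unique[OF _ has_integral_0] by fastforce
qed

text \<open>Integrated twice, the equation reads \<open>u x = a + b x\<close> plus a double integral
  of \<open>q u\<close>. It is solved by Banach's theorem for \<open>g = exp (- B x) u\<close> among
  bounded continuous functions, so the growth bound comes with the solution.\<close>

lemma exists_solution_c:
  assumes "tame V"
  shows "\<exists>u u' C B. solves_c V lam u u' \<and> u 0 = a \<and> u' 0 = b \<and> (\<forall>x<0. u x = 0) \<and>
    B \<ge> 0 \<and> (\<forall>x\<ge>0. \<bar>u x\<bar> \<le> C * exp (B * x) \<and> \<bar>u' x\<bar> \<le> C * exp (B * x))"
proof -
  define q where "q x = V x + - lam" for x
  have "tame (\<lambda>x. - lam)"
  proof (rule tame_bounded)
    show "potential_c (\<lambda>x. - lam)" by (auto simp: potential_c_def)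
    show "bounded_c (\<lambda>x. - lam)" unfolding bounded_c_def by (intro exI[of _ "\<bar>lam\<bar>"]) auto
  qed
  then have tq: "tame q" unfolding q_def by (intro tame_add assms)
  obtain K where K: "K \<ge> 0"
    "\<And>B t. B \<ge> 1 \<Longrightarrow> t \<ge> 0 \<Longrightarrow> integral {0..t} (\<lambda>s. \<bar>q s\<bar> * exp (B * s)) \<le> K * exp (B * t)"
    using tameE[OF tq] by blast
  have pq: "potential_c q" using tq by (simp add: tame_def)
  \<comment> \<open>The inner integral costs a factor \<open>K\<close> and the outer integral of
    \<open>exp (B t)\<close> gains \<open>1 / B\<close>, so \<open>2 * K \<le> B\<close> yields
    contraction constant 1/2. The class \<open>tame\<close> provides estimates for
    \<open>B \<ge> 1\<close> only.\<close>
  define B where "B = max 1 (2 * K)"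
  have B: "B \<ge> 1" "2 * K \<le> B" by (auto simp: B_def)
  \<comment> \<open>For \<open>u = exp (B x) g\<close>, these are the integral of
    \<open>q u\<close>, which is \<open>u' - b\<close>, and its integral.\<close>
  define I where "I g t = integral {0..t} (\<lambda>s. q s * (exp (B * s) * g s))" for g t
  define J where "J g x = integral {0..x} (I g)" for g x
  have pot: "potential_c (\<lambda>s. q s * (exp (B * s) * g s))" if "continuous_on {0..} g" for g
    unfolding potential_c_def using pq that
    by (intro allI impI potential_c_continuous_mult continuous_intros) auto
  have contI: "continuous_on {0..} (I g)" if "continuous_on {0..} g" for g
    unfolding I_def by (rule continuous_on_indefinite_integral_c[OF pot[OF that]])
  have intI: "I g integrable_on {0..x}" if "continuous_on {0..} g" for g x
    by (intro integrable_continuous_interval continuous_on_subset[OF contI[OF that]]) auto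
  have contJ: "continuous_on {0..} (J g)" if "continuous_on {0..} g" for g
    unfolding J_def using contI[OF that]
    by (intro continuous_on_indefinite_integral_c)
       (auto simp: potential_c_def intro!: absolutely_integrable_continuous_real elim: continuous_on_subset)
  have Idiff: "\<bar>I g t - I h t\<bar> \<le> M * K * exp (B * t)"
    if gh: "continuous_on {0..} g" "continuous_on {0..} h" "\<And>s. s \<ge> 0 \<Longrightarrow> \<bar>g s - h s\<bar> \<le> M" and t: "t \<ge> 0"
    for g h M t
  proof -
    have M: "M \<ge> 0" using gh(3)[of 0] by auto
    have int: "(\<lambda>s. q s * (exp (B * s) * f s)) integrable_on {0..t}" if "continuous_on {0..} f" for f
      using pot[OF that] t by (auto simp: potential_c_def absolutely_integrable_on_def)
    have "I g t - I h t = integral {0..t} (\<lambda>s. q s * (exp (B * s) * (g s - h s)))"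
      unfolding I_def using int[OF gh(1)] int[OF gh(2)]
      by (subst integral_diff[symmetric]) (auto simp: algebra_simps)
    also have "\<bar>\<dots>\<bar> \<le> integral {0..t} (\<lambda>s. \<bar>q s\<bar> * exp (B * s) * M)"
    proof -
      have "norm (integral {0..t} (\<lambda>s. q s * (exp (B * s) * (g s - h s)))) \<le> integral {0..t} (\<lambda>s. \<bar>q s\<bar> * exp (B * s) * M)"
      proof (rule integral_norm_bound_integral)
        show "(\<lambda>s. q s * (exp (B * s) * (g s - h s))) integrable_on {0..t}"
          by (intro int continuous_intros gh)
        show "(\<lambda>s. \<bar>q s\<bar> * exp (B * s) * M) integrable_on {0..t}"
          by (intro integrable_on_mult_left potential_c_weight_integrable pq t)
        show "norm (q s * (exp (B * s) * (g s - h s))) \<le> \<bar>q s\<bar> * exp (B * s) * M" if "s \<in> {0..t}" for s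
          using gh(3)[of s] that by (auto simp: abs_mult mult.assoc intro!: mult_left_mono)
      qed
      then show ?thesis by simp
    qed
    also have "\<dots> = integral {0..t} (\<lambda>s. \<bar>q s\<bar> * exp (B * s)) * M" by simp
    also have "\<dots> \<le> (K * exp (B * t)) * M" by (intro mult_right_mono K(2) B t M)
    finally show ?thesis by (simp add: ac_simps)
  qed
  have Jdiff: "exp (- (B * x)) * \<bar>J g x - J h x\<bar> \<le> M / 2"
    if gh: "continuous_on {0..} g" "continuous_on {0..} h" "\<And>s. s \<ge> 0 \<Longrightarrow> \<bar>g s - h s\<bar> \<le> M" and x: "x \<ge> 0"
    for g h M x
  proof -
    have M: "M \<ge> 0" using gh(3)[of 0] by auto
    have ex: "((\<lambda>t. M * K * exp (B * t)) has_integral (M * K * exp (B * x) / B - M * K * exp (B * 0) / B)) {0..x}"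
      using x B by (intro fundamental_theorem_of_calculus)
        (auto intro!: derivative_eq_intros simp flip: has_real_derivative_iff_has_vector_derivative)
    have "J g x - J h x = integral {0..x} (\<lambda>t. I g t - I h t)"
      unfolding J_def by (simp add: integral_diff intI gh)
    also have "norm \<dots> \<le> M * K * exp (B * x) / B - M * K * exp (B * 0) / B"
      unfolding integral_unique[OF ex, symmetric]
      by (rule integral_norm_bound_integral) (use ex Idiff[OF gh] in \<open>auto intro!: integrable_diff intI gh\<close>)
    also have "\<dots> \<le> M * K * exp (B * x) / B" using M K B by simp
    also have "\<dots> = M * (K / B) * exp (B * x)" by simp
    also have "\<dots> \<le> M * (1 / 2) * exp (B * x)"
      using B by (intro mult_right_mono mult_left_mono M) (auto simp: field_simps)
    finally have "exp (- (B * x)) * \<bar>J g x - J h x\<bar> \<le> exp (- (B * x)) * (M * (1 / 2) * exp (B * x))"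
      by (intro mult_left_mono) auto
    also have "\<dots> = M / 2" by (simp add: exp_minus)
    finally show ?thesis .
  qed
  \<comment> \<open>The type of bounded continuous functions lives on the whole line;
    \<open>max 0 x\<close> extends the half-line operator constantly to the left.\<close>
  define T where "T g x = exp (- (B * max 0 x)) * (a + b * max 0 x + J g (max 0 x))" for g :: "real \<Rightarrow> real" and x
  have Tb: "T g \<in> bcontfun" if g: "g \<in> bcontfun" for g
  proof -
    have cg: "continuous_on {0..} g" using g by (auto simp: bcontfun_def elim: continuous_on_subset)
    obtain M where M: "\<And>x. \<bar>g x\<bar> \<le> M" using g by (auto simp: bcontfun_def bounded_iff)
    have "continuous_on UNIV (T g)" unfolding T_def
      by (intro continuous_intros continuous_on_compose2[OF contJ[OF cg]]) auto
    moreover have "\<bar>T g x\<bar> \<le> \<bar>a\<bar> + \<bar>b\<bar> + M / 2" for x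
    proof -
      define y where "y = max 0 x"
      have y: "y \<ge> 0" by (simp add: y_def)
      have "J (\<lambda>_. 0) y = 0" by (simp add: J_def I_def[abs_def])
      then have 1: "exp (- (B * y)) * \<bar>J g y\<bar> \<le> M / 2"
        using Jdiff[OF cg, of "\<lambda>_. 0" M y] M y by simp
      have "y \<le> exp y" using exp_ge_add_one_self[of y] by linarith
      also have "\<dots> \<le> exp (B * y)" using B y by (simp add: mult_le_cancel_right1)
      finally have "exp (- (B * y)) * y \<le> 1" by (simp add: exp_minus field_simps)
      then have 2: "exp (- (B * y)) * (\<bar>b\<bar> * y) \<le> \<bar>b\<bar>"
        using mult_left_mono[of "exp (- (B * y)) * y" 1 "\<bar>b\<bar>"] by (simp add: ac_simps)
      have 3: "exp (- (B * y)) * \<bar>a\<bar> \<le> \<bar>a\<bar>" using B y by (intro mult_left_le_one_le) auto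
      have "\<bar>T g x\<bar> = exp (- (B * y)) * \<bar>a + b * y + J g y\<bar>" by (simp add: T_def y_def abs_mult)
      also have "\<dots> \<le> exp (- (B * y)) * (\<bar>a\<bar> + \<bar>b\<bar> * y + \<bar>J g y\<bar>)"
        using y abs_mult[of b y] by (intro mult_left_mono) auto
      finally show ?thesis using 1 2 3 by (simp add: algebra_simps)
    qed
    ultimately show ?thesis by (auto simp: bcontfun_def bounded_iff)
  qed
  define TT where "TT g = Bcontfun (T (apply_bcontfun g))" for g
  have TT: "apply_bcontfun (TT g) = T (apply_bcontfun g)" for g
    unfolding TT_def using Tb apply_bcontfun by (intro Bcontfun_inverse) blast
  have "dist (TT g) (TT h) \<le> 1 / 2 * dist g h" for g h
  proof (rule dist_bound)
    fix x
    have "\<bar>apply_bcontfun g s - apply_bcontfun h s\<bar> \<le> dist g h" for s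
      using dist_bounded[of g s h] by (simp add: dist_real_def)
    then have "exp (- (B * max 0 x)) * \<bar>J g (max 0 x) - J h (max 0 x)\<bar> \<le> dist g h / 2"
      by (intro Jdiff) auto
    moreover have "dist (TT g x) (TT h x) = exp (- (B * max 0 x)) * \<bar>J g (max 0 x) - J h (max 0 x)\<bar>"
      unfolding TT T_def dist_real_def right_diff_distrib[symmetric] abs_mult by simp
    ultimately show "dist (TT g x) (TT h x) \<le> 1 / 2 * dist g h" by simp
  qed
  then obtain G where "TT G = G" using banach_fix_type[of "1/2" TT] by auto
  define g where "g = apply_bcontfun G"
  have Tg: "T g = g" using TT[of G] \<open>TT G = G\<close> by (simp add: g_def)
  have cg: "continuous_on {0..} g" by (simp add: g_def)
  obtain M where M: "\<And>x. \<bar>g x\<bar> \<le> M" using bounded_apply_bcontfun[of G] by (auto simp: bounded_iff g_def)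
  \<comment> \<open>The cut at negative arguments matches the normalization in
    \<open>phi1_c\<close>.\<close>
  define u where "u x = (if x < 0 then 0 else exp (B * x) * g x)" for x
  define u' where "u' x = b + I g x" for x
  have u_eq: "u x = a + b * x + J g x" if "x \<ge> 0" for x
  proof -
    have "g x = exp (- (B * x)) * (a + b * x + J g x)" using fun_cong[OF Tg, of x] that by (simp add: T_def)
    then show ?thesis using that by (simp add: u_def exp_minus)
  qed
  have du: "(u has_real_derivative u' x) (at x within {0..})" if x: "x \<ge> 0" for x
  proof -
    have "((\<lambda>x. integral {0..x} (I g)) has_real_derivative I g x) (at x within {0..x + 1})"
      using x by (intro integral_has_real_derivative continuous_on_subset[OF contI[OF cg]]) auto
    moreover have "at x within {0..x + 1} = at x within {0..}"
      using x by (intro at_within_nhd[of x "{..<x + 1}"]) auto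
    ultimately have "(J g has_real_derivative I g x) (at x within {0..})" by (simp add: J_def[abs_def])
    then have "((\<lambda>x. a + b * x + J g x) has_real_derivative u' x) (at x within {0..})"
      unfolding u'_def by (auto intro!: derivative_eq_intros)
    then show ?thesis
      by (rule has_field_derivative_transform_within[OF _ zero_less_one]) (use x u_eq in auto)
  qed
  have "solves_c V lam u u'" unfolding solves_c_def
  proof (intro conjI exI[of _ "\<lambda>s. q s * (exp (B * s) * g s)"] allI impI du)
    fix x :: real assume "x \<ge> 0"
    show "(\<lambda>s. q s * (exp (B * s) * g s)) absolutely_integrable_on {0..x}"
      using pot[OF cg] \<open>x \<ge> 0\<close> by (simp add: potential_c_def)
    show "u' x = u' 0 + integral {0..x} (\<lambda>s. q s * (exp (B * s) * g s))"
      by (simp add: u'_def I_def)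
  qed (auto simp: u_def q_def algebra_simps)
  moreover have "u 0 = a" "u' 0 = b" using u_eq[of 0] by (auto simp: u'_def J_def I_def)
  moreover have "\<forall>x<0. u x = 0" by (simp add: u_def)
  \<comment> \<open>A common constant: \<open>M\<close> serves for \<open>u\<close>, while
    \<open>\<bar>b\<bar> + M * K\<close> serves for \<open>u' = b + I g\<close>.\<close>
  moreover have "\<bar>u x\<bar> \<le> (M + \<bar>b\<bar> + M * K) * exp (B * x) \<and> \<bar>u' x\<bar> \<le> (M + \<bar>b\<bar> + M * K) * exp (B * x)"
    if x: "x \<ge> 0" for x
  proof
    have M0: "M \<ge> 0" using M[of 0] by linarith
    have "\<bar>u x\<bar> = \<bar>g x\<bar> * exp (B * x)" using x by (simp add: u_def abs_mult)
    also have "\<dots> \<le> (M + \<bar>b\<bar> + M * K) * exp (B * x)"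
      using M[of x] M0 K(1) by (intro mult_right_mono) (auto intro!: add_increasing2)
    finally show "\<bar>u x\<bar> \<le> (M + \<bar>b\<bar> + M * K) * exp (B * x)" .
    have "\<bar>I g x\<bar> \<le> M * K * exp (B * x)"
      using Idiff[OF cg, of "\<lambda>_. 0" M x] M x by (simp add: I_def)
    moreover have "\<bar>b\<bar> \<le> \<bar>b\<bar> * exp (B * x)" using B x by (simp add: mult_le_cancel_left1)
    moreover have "0 \<le> M * exp (B * x)" using M0 by simp
    ultimately show "\<bar>u' x\<bar> \<le> (M + \<bar>b\<bar> + M * K) * exp (B * x)"
      unfolding u'_def distrib_right by linarith
  qed
  ultimately show ?thesis using B by (intro exI[of _ u] exI[of _ u'] exI[of _ "M + \<bar>b\<bar> + M * K"] exI[of _ B]) auto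
qed

section \<open>Fundamental systems and the description of \<open>P_c\<close> by
  square-integrability\<close>

locale basis_c =
  fixes V :: "real \<Rightarrow> real" and lam :: real and al al' be be' :: "real \<Rightarrow> real"
  assumes sol: "solves_c V lam al al'" "solves_c V lam be be'"
    and init: "al 0 = 1" "al' 0 = 0" "be 0 = 0" "be' 0 = 1"
    and neg: "\<And>x. x < 0 \<Longrightarrow> al x = 0" "\<And>x. x < 0 \<Longrightarrow> be x = 0"
begin

lemma wronskian_basis: "x \<ge> 0 \<Longrightarrow> al x * be' x - al' x * be x = 1"
  using wronskian_const_c[OF sol] by (simp add: init)

lemma combination_solves:
  "solves_c V lam (\<lambda>x. a * al x + b * be x) (\<lambda>x. a * al' x + b * be' x)"
  by (rule solves_c_linear[OF sol])

text \<open>The Wronskians of \<open>u\<close> with the basis are constant and equal to its initial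
  data up to sign; as the basis has Wronskian 1, Cramer's rule recovers \<open>u\<close> and
  \<open>u'\<close>. This doubles as uniqueness for the initial value problem, as
  \<open>phi1_c_eq\<close> requires.\<close>

lemma solution_eq:
  assumes "solves_c V lam u u'" "x \<ge> 0"
  shows "u x = u 0 * al x + u' 0 * be x" "u' x = u 0 * al' x + u' 0 * be' x"
proof -
  have w: "u x * al' x - u' x * al x = - u' 0" "u x * be' x - u' x * be x = u 0"
    using wronskian_const_c[OF assms(1) sol(1) assms(2)] wronskian_const_c[OF assms(1) sol(2) assms(2)]
    by (simp_all add: init)
  note d = wronskian_basis[OF assms(2)]
  have "u x = u x * (al x * be' x - al' x * be x)" by (simp add: d)
  also have "\<dots> = (u x * be' x - u' x * be x) * al x - (u x * al' x - u' x * al x) * be x"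
    by (simp add: algebra_simps)
  finally show "u x = u 0 * al x + u' 0 * be x" by (simp add: w)
  have "u' x = u' x * (al x * be' x - al' x * be x)" by (simp add: d)
  also have "\<dots> = (u x * be' x - u' x * be x) * al' x - (u x * al' x - u' x * al x) * be' x"
    by (simp add: algebra_simps)
  finally show "u' x = u 0 * al' x + u' 0 * be' x" by (simp add: w)
qed

lemma phi1_c_eq: "phi1_c V \<theta> lam = (\<lambda>x. sin \<theta> * al x + - cos \<theta> * be x)"
  unfolding phi1_c_def
proof (rule the_equality)
  show "(\<forall>x<0. sin \<theta> * al x + - cos \<theta> * be x = 0) \<and>
    (\<exists>\<phi>'. solves_c V lam (\<lambda>x. sin \<theta> * al x + - cos \<theta> * be x) \<phi>' \<and>
      sin \<theta> * al 0 + - cos \<theta> * be 0 = sin \<theta> \<and> \<phi>' 0 = - cos \<theta>)"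
    using combination_solves[of "sin \<theta>" "- cos \<theta>"] by (auto simp: neg init)
next
  fix u assume "(\<forall>x<0. u x = 0) \<and> (\<exists>u'. solves_c V lam u u' \<and> u 0 = sin \<theta> \<and> u' 0 = - cos \<theta>)"
  then obtain u' where u: "\<forall>x<0. u x = 0" "solves_c V lam u u'" "u 0 = sin \<theta>" "u' 0 = - cos \<theta>" by blast
  show "u = (\<lambda>x. sin \<theta> * al x + - cos \<theta> * be x)"
  proof
    fix x show "u x = sin \<theta> * al x + - cos \<theta> * be x"
      using u solution_eq(1)[OF u(2), of x] neg[of x] by (cases "x < 0") auto
  qed
qed

lemma continuous_on_combination: "continuous_on {0..} (\<lambda>x. a * al x + b * be x)"
  using combination_solves by (rule solves_c_continuous)

lemma integrable_square: "(\<lambda>x. \<bar>a * al x + b * be x\<bar>\<^sup>2) integrable_on {0..L}"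
  by (intro integrable_continuous_interval continuous_intros continuous_on_subset[OF continuous_on_combination]) auto

sublocale solution_norms "\<lambda>L a b. normL_c L (\<lambda>x. a * al x + b * be x)"
proof
  fix L M a b c d r :: real
  show "0 \<le> normL_c L (\<lambda>x. a * al x + b * be x)"
    unfolding normL_c_def by (intro real_sqrt_ge_zero integral_nonneg integrable_square) auto
  have nn: "0 \<le> integral {0..L} (\<lambda>x. \<bar>a * al x + b * be x\<bar>\<^sup>2)" for L a b
    by (intro integral_nonneg integrable_square) auto
  show "normL_c L (\<lambda>x. (a + c) * al x + (b + d) * be x) \<le>
      2 * (normL_c L (\<lambda>x. a * al x + b * be x) + normL_c L (\<lambda>x. c * al x + d * be x))"
  proof -
    define s t where "s = integral {0..L} (\<lambda>x. \<bar>a * al x + b * be x\<bar>\<^sup>2)"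
      and "t = integral {0..L} (\<lambda>x. \<bar>c * al x + d * be x\<bar>\<^sup>2)"
    have st: "s \<ge> 0" "t \<ge> 0" using nn by (auto simp: s_def t_def)
    have "integral {0..L} (\<lambda>x. \<bar>(a + c) * al x + (b + d) * be x\<bar>\<^sup>2) \<le>
        integral {0..L} (\<lambda>x. 2 * \<bar>a * al x + b * be x\<bar>\<^sup>2 + 2 * \<bar>c * al x + d * be x\<bar>\<^sup>2)"
    proof (intro integral_le integrable_square integrable_add integrable_on_mult_right)
      fix x
      \<comment> \<open>Parallelogram identity; dropping the second square on the left gives the
        pointwise bound.\<close>
      have "((a + c) * al x + (b + d) * be x)\<^sup>2 + ((a - c) * al x + (b - d) * be x)\<^sup>2 =
          2 * (a * al x + b * be x)\<^sup>2 + 2 * (c * al x + d * be x)\<^sup>2"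
        by (simp add: power2_eq_square algebra_simps)
      then show "\<bar>(a + c) * al x + (b + d) * be x\<bar>\<^sup>2 \<le> 2 * \<bar>a * al x + b * be x\<bar>\<^sup>2 + 2 * \<bar>c * al x + d * be x\<bar>\<^sup>2"
        unfolding power2_abs by (metis le_add_same_cancel1 zero_le_power2)
    qed
    also have "\<dots> = 2 * s + 2 * t"
      using integral_add[OF integrable_on_mult_right[OF integrable_square[where a = a and b = b and L = L], of 2]
          integrable_on_mult_right[OF integrable_square[where a = c and b = d and L = L], of 2]]
      unfolding s_def t_def integral_mult_right .
    also have "\<dots> \<le> (2 * (sqrt s + sqrt t))\<^sup>2"
      using st by (simp add: power2_sum power_mult_distrib)
    finally have "sqrt (integral {0..L} (\<lambda>x. \<bar>(a + c) * al x + (b + d) * be x\<bar>\<^sup>2)) \<le> 2 * (sqrt s + sqrt t)"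
      using st by (intro real_le_lsqrt) auto
    then show ?thesis by (simp add: normL_c_def s_def t_def)
  qed
  show "normL_c L (\<lambda>x. r * a * al x + r * b * be x) = \<bar>r\<bar> * normL_c L (\<lambda>x. a * al x + b * be x)"
  proof -
    have "(\<lambda>x. \<bar>r * a * al x + r * b * be x\<bar>\<^sup>2) = (\<lambda>x. r\<^sup>2 * \<bar>a * al x + b * be x\<bar>\<^sup>2)"
      by (simp add: fun_eq_iff power_mult_distrib[symmetric] algebra_simps)
    then show ?thesis by (simp only: normL_c_def integral_mult_right real_sqrt_mult real_sqrt_abs)
  qed
  show "0 \<le> L \<Longrightarrow> L \<le> M \<Longrightarrow> normL_c L (\<lambda>x. a * al x + b * be x) \<le> normL_c M (\<lambda>x. a * al x + b * be x)"
    unfolding normL_c_def by (intro real_sqrt_le_mono integral_subset_le integrable_square) auto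
  show "\<exists>L\<ge>0. 0 < normL_c L (\<lambda>x. a * al x + b * be x)" if ab: "a \<noteq> 0 \<or> b \<noteq> 0"
  proof (rule ccontr)
    \<comment> \<open>If all norms vanish, the continuous combination is 0 on the half-line. Its
      value at 0 is \<open>a\<close>, and its one-sided derivative there, unique because 0 is not
      isolated in the half-line, is \<open>b\<close>.\<close>
    assume "\<not> ?thesis"
    then have z: "integral {0..L} (\<lambda>x. \<bar>a * al x + b * be x\<bar>\<^sup>2) = 0" if "L \<ge> 0" for L
      using nn[where L = L and a = a and b = b] that unfolding normL_c_def by (force simp: not_less)
    have 0: "a * al x + b * be x = 0" if x: "x \<ge> 0" for x
    proof -
      have c: "continuous_on (cbox 0 (x + 1)) (\<lambda>x. \<bar>a * al x + b * be x\<bar>\<^sup>2)"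
        by (intro continuous_intros continuous_on_subset[OF continuous_on_combination]) auto
      have i: "((\<lambda>x. \<bar>a * al x + b * be x\<bar>\<^sup>2) has_integral 0) (cbox 0 (x + 1))"
        using integrable_square z[of "x + 1"] x by (simp only: has_integral_iff box_real)
      have "\<bar>a * al x + b * be x\<bar>\<^sup>2 = 0"
        by (rule has_integral_0_cbox_imp_0[OF c _ i]) (use x in auto)
      then show ?thesis by simp
    qed
    then have "a = 0" using 0[of 0] by (simp add: init)
    have "((\<lambda>x. a * al x + b * be x) has_real_derivative b) (at 0 within {0..})"
      using combination_solves[of a b] unfolding solves_c_def by (auto simp: init)
    moreover have "((\<lambda>x. a * al x + b * be x) has_real_derivative 0) (at 0 within {0..})"
      by (rule has_field_derivative_transform_within[OF DERIV_const zero_less_one, of 0]) (use 0 in auto)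
    moreover have "at (0::real) within {0..} \<noteq> bot" by (simp add: at_within_Ici_at_right)
    ultimately have "b = 0"
      unfolding has_field_derivative_iff by (rule tendsto_unique[rotated])
    with \<open>a = 0\<close> ab show False by simp
  qed
qed

end

definition L2_c :: "(real \<Rightarrow> real) \<Rightarrow> bool" where
  "L2_c u \<longleftrightarrow> (\<lambda>x. \<bar>u x\<bar>\<^sup>2) absolutely_integrable_on {0..}"

lemma L2_c_cong: "(\<And>x. x \<ge> 0 \<Longrightarrow> u x = v x) \<Longrightarrow> L2_c u \<longleftrightarrow> L2_c v"
  unfolding L2_c_def absolutely_integrable_on_def by (intro conj_cong integrable_cong) auto

text \<open>Bounded norms yield integrability by monotone convergence along the truncations to
  \<open>{0..real k}\<close>.\<close>

lemma L2_c_iff_bounded: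
  assumes "continuous_on {0..} u"
  shows "L2_c u \<longleftrightarrow> (\<exists>C. \<forall>L\<ge>0. normL_c L u \<le> C)"
proof -
  have int: "(\<lambda>x. \<bar>u x\<bar>\<^sup>2) integrable_on {0..L}" for L
    by (intro integrable_continuous_interval continuous_intros continuous_on_subset[OF assms]) auto
  have nn: "0 \<le> integral {0..L} (\<lambda>x. \<bar>u x\<bar>\<^sup>2)" for L
    by (intro integral_nonneg int) auto
  show ?thesis
  proof
    assume "L2_c u"
    then have i: "(\<lambda>x. \<bar>u x\<bar>\<^sup>2) integrable_on {0..}" by (simp add: L2_c_def absolutely_integrable_on_def)
    have "normL_c L u \<le> sqrt (integral {0..} (\<lambda>x. \<bar>u x\<bar>\<^sup>2))" for L
      unfolding normL_c_def by (intro real_sqrt_le_mono integral_subset_le int i) auto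
    then show "\<exists>C. \<forall>L\<ge>0. normL_c L u \<le> C" by blast
  next
    assume "\<exists>C. \<forall>L\<ge>0. normL_c L u \<le> C"
    then obtain C where C: "\<And>L. L \<ge> 0 \<Longrightarrow> normL_c L u \<le> C" by blast
    have le: "integral {0..L} (\<lambda>x. \<bar>u x\<bar>\<^sup>2) \<le> C\<^sup>2" if "L \<ge> 0" for L
      using C[OF that] nn[of L] unfolding normL_c_def by (simp add: sqrt_le_D)
    have "(\<lambda>x. \<bar>u x\<bar>\<^sup>2) integrable_on {0..} \<and>
      (\<lambda>k. integral {0..} (\<lambda>x. if x \<in> {0..real k} then \<bar>u x\<bar>\<^sup>2 else 0)) \<longlonglongrightarrow> integral {0..} (\<lambda>x. \<bar>u x\<bar>\<^sup>2)"
    proof (rule monotone_convergence_increasing)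
      have sub: "{0..real k} \<inter> {0..} = {0..real k}" for k by auto
      show "(\<lambda>x. if x \<in> {0..real k} then \<bar>u x\<bar>\<^sup>2 else 0) integrable_on {0..}" for k
        using int[of "real k"] by (simp only: integrable_restrict_Int sub)
      have "integral {0..} (\<lambda>x. if x \<in> {0..real k} then \<bar>u x\<bar>\<^sup>2 else 0) = integral {0..real k} (\<lambda>x. \<bar>u x\<bar>\<^sup>2)" for k
        by (simp only: integral_restrict_Int sub)
      then show "bounded (range (\<lambda>k. integral {0..} (\<lambda>x. if x \<in> {0..real k} then \<bar>u x\<bar>\<^sup>2 else 0)))"
        unfolding bounded_iff using le nn by (intro exI[of _ "C\<^sup>2"]) (auto simp del: power2_abs)
      show "(\<lambda>k. if x \<in> {0..real k} then \<bar>u x\<bar>\<^sup>2 else 0) \<longlonglongrightarrow> \<bar>u x\<bar>\<^sup>2" if "x \<in> {0..}" for x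
      proof (rule tendsto_eventually)
        obtain n where "x \<le> real n" using real_arch_simple by blast
        then show "\<forall>\<^sub>F k in sequentially. (if x \<in> {0..real k} then \<bar>u x\<bar>\<^sup>2 else 0) = \<bar>u x\<bar>\<^sup>2"
          using that by (intro eventually_sequentiallyI[of n]) auto
      qed
    qed auto
    then show "L2_c u" unfolding L2_c_def by (intro nonnegative_absolutely_integrable_1) auto
  qed
qed

lemma exists_basis_c:
  assumes "tame V"
  obtains al al' be be' B C where "basis_c V lam al al' be be'" "B \<ge> 0"
    "\<forall>x\<ge>0. \<bar>al x\<bar> \<le> C * exp (B * x)" "\<forall>x\<ge>0. \<bar>al' x\<bar> \<le> C * exp (B * x)"
    "\<forall>x\<ge>0. \<bar>be x\<bar> \<le> C * exp (B * x)" "\<forall>x\<ge>0. \<bar>be' x\<bar> \<le> C * exp (B * x)"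
proof -
  obtain al al' C1 B1 where al: "solves_c V lam al al'" "al 0 = 1" "al' 0 = 0" "\<forall>x<0. al x = 0" "B1 \<ge> 0"
    "\<forall>x\<ge>0. \<bar>al x\<bar> \<le> C1 * exp (B1 * x) \<and> \<bar>al' x\<bar> \<le> C1 * exp (B1 * x)"
    using exists_solution_c[OF assms, of lam 1 0] by blast
  obtain be be' C2 B2 where be: "solves_c V lam be be'" "be 0 = 0" "be' 0 = 1" "\<forall>x<0. be x = 0" "B2 \<ge> 0"
    "\<forall>x\<ge>0. \<bar>be x\<bar> \<le> C2 * exp (B2 * x) \<and> \<bar>be' x\<bar> \<le> C2 * exp (B2 * x)"
    using exists_solution_c[OF assms, of lam 0 1] by blast
  have mono: "y \<le> max C1 C2 * exp (max B1 B2 * x)" if "y \<le> C * exp (B * x)" "C = C1 \<or> C = C2" "B = B1 \<or> B = B2" "x \<ge> 0" "0 \<le> y" for x y C B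
  proof -
    have "0 \<le> C * exp (B * x)" using that by linarith
    then have "C \<ge> 0" by (simp add: zero_le_mult_iff)
    then have "C * exp (B * x) \<le> max C1 C2 * exp (max B1 B2 * x)"
      using that by (intro mult_mono) (auto intro!: mult_right_mono)
    with that show ?thesis by linarith
  qed
  show thesis
  proof (rule that[of al al' be be' "max B1 B2" "max C1 C2"])
    show "basis_c V lam al al' be be'" using al be by unfold_locales auto
    show "max B1 B2 \<ge> 0" using al(5) by simp
    show "\<forall>x\<ge>0. \<bar>al x\<bar> \<le> max C1 C2 * exp (max B1 B2 * x)" "\<forall>x\<ge>0. \<bar>al' x\<bar> \<le> max C1 C2 * exp (max B1 B2 * x)"
      using al(6) by (auto intro: mono[of _ C1 B1])
    show "\<forall>x\<ge>0. \<bar>be x\<bar> \<le> max C1 C2 * exp (max B1 B2 * x)" "\<forall>x\<ge>0. \<bar>be' x\<bar> \<le> max C1 C2 * exp (max B1 B2 * x)"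
      using be(6) by (auto intro: mono[of _ C2 B2])
  qed
qed

text \<open>Quantifying over solutions instead of initial data frees the criterion from the basis
  and from the angle, so that it can be transported to another potential.\<close>

lemma P_c_iff:
  assumes "tame V"
  shows "lam \<in> P_c V \<longleftrightarrow>
    (\<exists>u u'. solves_c V lam u u' \<and> (u 0 \<noteq> 0 \<or> u' 0 \<noteq> 0) \<and> L2_c u) \<and> (\<exists>u u'. solves_c V lam u u' \<and> \<not> L2_c u)"
proof -
  obtain al al' be be' B C where "basis_c V lam al al' be be'" using exists_basis_c[OF assms] .
  then interpret basis_c V lam al al' be be' .
  have sub: "subordinate_c V lam \<theta> \<longleftrightarrow> sub \<theta>" for \<theta>
    unfolding subordinate_c_def sub_def phi2_c_def phi1_c_eq ..
  have bd: "bd a b \<longleftrightarrow> L2_c (\<lambda>x. a * al x + b * be x)" for a b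
    unfolding bd_def by (rule L2_c_iff_bounded[OF continuous_on_combination, symmetric])
  have L2: "L2_c u \<longleftrightarrow> bd (u 0) (u' 0)" if "solves_c V lam u u'" for u u'
    unfolding bd by (rule L2_c_cong) (rule solution_eq(1)[OF that])
  have "lam \<in> P_c V \<longleftrightarrow> (\<exists>\<theta>\<in>{0..<pi}. sub \<theta>) \<and>
     bd (sin (THE \<theta>. \<theta> \<in> {0..<pi} \<and> sub \<theta>)) (- cos (THE \<theta>. \<theta> \<in> {0..<pi} \<and> sub \<theta>))"
    by (simp add: P_c_def theta_c_def sub phi1_c_eq bd L2_c_def)
  also have "\<dots> \<longleftrightarrow> (\<exists>a b. (a \<noteq> 0 \<or> b \<noteq> 0) \<and> bd a b) \<and> (\<exists>a b. \<not> bd a b)"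
    by (rule sub_bd_iff)
  also have "(\<exists>a b. (a \<noteq> 0 \<or> b \<noteq> 0) \<and> bd a b) \<longleftrightarrow> (\<exists>u u'. solves_c V lam u u' \<and> (u 0 \<noteq> 0 \<or> u' 0 \<noteq> 0) \<and> L2_c u)"
    (is "?l1 \<longleftrightarrow> ?r1")
  proof
    assume ?l1
    then obtain a b where ab: "a \<noteq> 0 \<or> b \<noteq> 0" "bd a b" by blast
    then show ?r1 using combination_solves[of a b]
      by (intro exI[of _ "\<lambda>x. a * al x + b * be x"] exI[of _ "\<lambda>x. a * al' x + b * be' x"]) (auto simp: bd init)
  qed (use L2 in blast)
  also have "(\<exists>a b. \<not> bd a b) \<longleftrightarrow> (\<exists>u u'. solves_c V lam u u' \<and> \<not> L2_c u)"
    using L2 combination_solves bd by blast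
  finally show ?thesis .
qed

section \<open>Transfer of solutions between two potentials on the half-line\<close>

lemma L2_c_perturb:
  assumes u: "continuous_on {0..} u" and v: "continuous_on {0..} v"
    and d: "\<And>x. x \<ge> 0 \<Longrightarrow> \<bar>u x - v x\<bar> \<le> C * exp (- x)" and L2: "L2_c u"
  shows "L2_c v"
proof -
  have vint: "(\<lambda>x. \<bar>v x\<bar>\<^sup>2) integrable_on {0..b}" for b
    by (intro integrable_continuous_interval continuous_intros continuous_on_subset[OF v]) auto
  have "(\<lambda>x. exp (- 2 * x)) integrable_on {0::real..}"
    using integrable_on_exp_minus_to_infinity[of 2 0] by simp
  then have i: "(\<lambda>x. 2 * \<bar>u x\<bar>\<^sup>2 + 2 * C\<^sup>2 * exp (- 2 * x)) integrable_on {0..}"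
    using L2 unfolding L2_c_def absolutely_integrable_on_def
    by (intro integrable_add integrable_on_mult_right) auto
  have le: "\<bar>v x\<bar>\<^sup>2 \<le> 2 * \<bar>u x\<bar>\<^sup>2 + 2 * C\<^sup>2 * exp (- 2 * x)" if "x \<ge> 0" for x
  proof -
    \<comment> \<open>Parallelogram identity for \<open>u x\<close> and
      \<open>v x - u x\<close>.\<close>
    have "(v x)\<^sup>2 + (2 * u x - v x)\<^sup>2 = 2 * (u x)\<^sup>2 + 2 * (u x - v x)\<^sup>2"
      by (simp add: power2_eq_square algebra_simps)
    then have "(v x)\<^sup>2 \<le> 2 * (u x)\<^sup>2 + 2 * (u x - v x)\<^sup>2"
      by (metis le_add_same_cancel1 zero_le_power2)
    moreover have "(u x - v x)\<^sup>2 \<le> (C * exp (- x))\<^sup>2"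
      using power_mono[OF d[OF that] abs_ge_zero, of 2] by simp
    moreover have "(C * exp (- x))\<^sup>2 = C\<^sup>2 * exp (- 2 * x)"
      by (simp add: power_mult_distrib flip: exp_double)
    ultimately show ?thesis by simp
  qed
  have "(\<lambda>x. \<bar>v x\<bar>\<^sup>2) integrable_on {0..}"
  proof (rule measurable_bounded_by_integrable_imp_integrable[OF _ i])
    show "(\<lambda>x. \<bar>v x\<bar>\<^sup>2) \<in> borel_measurable (lebesgue_on {0..})"
      by (intro continuous_imp_measurable_on_sets_lebesgue continuous_intros v) auto
    show "norm (\<bar>v x\<bar>\<^sup>2) \<le> 2 * \<bar>u x\<bar>\<^sup>2 + 2 * C\<^sup>2 * exp (- 2 * x)" if "x \<in> {0..}" for x
      using le[of x] that by simp
  qed auto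
  then show ?thesis unfolding L2_c_def by (intro nonnegative_absolutely_integrable_1) auto
qed

lemma absolutely_integrable_Ici_bound:
  fixes f h :: "real \<Rightarrow> real"
  assumes f: "\<And>b. b \<ge> 0 \<Longrightarrow> f integrable_on {0..b}"
    and h: "\<And>x. x \<ge> 0 \<Longrightarrow> \<bar>f x\<bar> \<le> h x" "h integrable_on {0..}"
  shows "f absolutely_integrable_on {0..}"
proof -
  have "f integrable_on {0..}"
  proof (rule integrable_on_all_intervals_integrable_bound[OF _ _ h(2)])
    show "(\<lambda>x. if x \<in> {0..} then f x else 0) integrable_on cbox c d" for c d
    proof -
      have "{0..} \<inter> cbox c d = {max 0 c..d}" by auto
      moreover have "f integrable_on {max 0 c..d}"
        by (rule integrable_on_subinterval[OF f[of "max 0 d"]]) auto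
      ultimately show ?thesis by (simp only: integrable_restrict_Int)
    qed
  qed (use h in auto)
  then show ?thesis
    using h by (intro absolutely_integrable_integrable_bound[of "{0..}" f h]) auto
qed

text \<open>The limit is the Wronskian at 0 plus the integral of \<open>(V2 - V1) u v\<close> over
  the half-line, and the error is the tail of that integral. The order of quantifiers matters:
  \<open>w\<close> is the same for all rates \<open>A\<close>, only \<open>D\<close> varies.\<close>

lemma wronskian_limit_c:
  assumes u: "solves_c V1 lam u u'" and v: "solves_c V2 lam v v'"
    and W: "\<And>A. A > 0 \<Longrightarrow> (\<lambda>x. (V2 x - V1 x) * exp (A * x)) absolutely_integrable_on {0..}"
    and B: "B \<ge> 0" and gu: "\<And>x. x \<ge> 0 \<Longrightarrow> \<bar>u x\<bar> \<le> C * exp (B * x)"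
    and gv: "\<And>x. x \<ge> 0 \<Longrightarrow> \<bar>v x\<bar> \<le> C * exp (B * x)"
  shows "\<exists>w. \<forall>A>0. \<exists>D. \<forall>x\<ge>0. \<bar>(u x * v' x - u' x * v x) - w\<bar> \<le> D * exp (- (A * x))"
proof -
  define g where "g t = (V2 t - V1 t) * u t * v t" for t
  define b where "b A t = \<bar>V2 t - V1 t\<bar> * exp (A * t)" for A t
  have bint: "b A integrable_on {0..}" if "A > 0" for A
    using W[OF that] unfolding b_def absolutely_integrable_on_def by (simp add: abs_mult)
  \<comment> \<open>The two solutions cost the rate \<open>2 * B\<close>; the factor
    \<open>exp (A * (t - x))\<close>, at least 1 for \<open>t \<ge> x\<close>, extracts the decay in
    \<open>x\<close>. Hence the weight with rate \<open>A + 2 * B\<close>.\<close>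
  have C2: "\<bar>g t\<bar> \<le> C\<^sup>2 * exp (- (A * x)) * b (A + 2 * B) t" if "x \<le> t" "t \<ge> 0" "A > 0" for A x t
  proof -
    have "\<bar>g t\<bar> = \<bar>V2 t - V1 t\<bar> * (\<bar>u t\<bar> * \<bar>v t\<bar>)" by (simp add: g_def abs_mult)
    also have "\<dots> \<le> \<bar>V2 t - V1 t\<bar> * ((C * exp (B * t)) * (C * exp (B * t)))"
      using gu[OF that(2)] gv[OF that(2)] by (intro mult_left_mono mult_mono) auto
    also have "\<dots> = \<bar>V2 t - V1 t\<bar> * C\<^sup>2 * exp (2 * B * t) * 1"
      by (simp add: power2_eq_square mult.assoc exp_double)
    also have "\<dots> \<le> \<bar>V2 t - V1 t\<bar> * C\<^sup>2 * exp (2 * B * t) * exp (A * (t - x))"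
      using that by (intro mult_left_mono) auto
    also have "\<dots> = C\<^sup>2 * exp (- (A * x)) * b (A + 2 * B) t"
      by (simp add: b_def algebra_simps flip: exp_add)
    finally show ?thesis .
  qed
  have gint0: "g integrable_on {0..x}" if "x \<ge> 0" for x
    using wronskian_c[OF u v that] unfolding g_def by blast
  have gabs: "g absolutely_integrable_on {0..}"
  proof (rule absolutely_integrable_Ici_bound[OF gint0])
    show "\<bar>g x\<bar> \<le> C\<^sup>2 * b (1 + 2 * B) x" if "x \<ge> 0" for x
      using C2[of 0 x 1] that by simp
    show "(\<lambda>x. C\<^sup>2 * b (1 + 2 * B) x) integrable_on {0..}"
      using B by (intro integrable_on_mult_right bint) auto
  qed
  define w where "w = u 0 * v' 0 - u' 0 * v 0 + integral {0..} g"
  show ?thesis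
  proof (rule exI[of _ w], intro allI impI)
    fix A :: real assume A: "A > 0"
    have "\<bar>(u x * v' x - u' x * v x) - w\<bar> \<le> C\<^sup>2 * integral {0..} (b (A + 2 * B)) * exp (- (A * x))" if x: "x \<ge> 0" for x
    proof -
      have AB: "A + 2 * B > 0" using A B by simp
      have un: "{0..} = {0..x} \<union> {x..}" using x by auto
      have "g absolutely_integrable_on {x..}"
        using x by (intro set_integrable_subset[OF gabs]) auto
      then have gx: "g integrable_on {x..}" by (simp add: absolutely_integrable_on_def)
      have babs: "b (A + 2 * B) absolutely_integrable_on {0..}"
        using bint[OF AB] by (rule nonnegative_absolutely_integrable_1) (simp add: b_def)
      have "b (A + 2 * B) absolutely_integrable_on {x..}"
        using x by (intro set_integrable_subset[OF babs]) auto
      then have bx: "b (A + 2 * B) integrable_on {x..}" by (simp add: absolutely_integrable_on_def)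
      have "integral {0..} g = integral {0..x} g + integral {x..} g"
        unfolding un by (rule Henstock_Kurzweil_Integration.integral_Un) (use gint0[OF x] gx in \<open>auto intro: negligible_subset[of "{x}"]\<close>)
      moreover have "integral {0..x} g = (u x * v' x - u' x * v x) - (u 0 * v' 0 - u' 0 * v 0)"
        using wronskian_c[OF u v x] unfolding g_def by (rule integral_unique)
      ultimately have "\<bar>(u x * v' x - u' x * v x) - w\<bar> = norm (integral {x..} g)"
        by (simp add: w_def)
      also have "\<dots> \<le> integral {x..} (\<lambda>t. C\<^sup>2 * exp (- (A * x)) * b (A + 2 * B) t)"
        using x C2[OF _ _ A] by (intro integral_norm_bound_integral gx integrable_on_mult_right bx) auto
      also have "\<dots> = C\<^sup>2 * exp (- (A * x)) * integral {x..} (b (A + 2 * B))" by simp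
      also have "\<dots> \<le> C\<^sup>2 * exp (- (A * x)) * integral {0..} (b (A + 2 * B))"
        using x by (intro mult_left_mono integral_subset_le bx bint AB) (auto simp: b_def)
      finally show ?thesis by (simp add: ac_simps)
    qed
    then show "\<exists>D. \<forall>x\<ge>0. \<bar>(u x * v' x - u' x * v x) - w\<bar> \<le> D * exp (- (A * x))" by blast
  qed
qed

text \<open>Cramer's rule writes \<open>u\<close> in the basis for \<open>V2\<close> with the
  Wronskians \<open>wb\<close> and \<open>- wa\<close> as variable coefficients; \<open>v\<close>
  has their limits \<open>b\<close> and \<open>- a\<close> instead. If both limits vanish,
  \<open>u\<close> and \<open>u'\<close> decay faster than solutions for \<open>V1\<close> can grow,
  which forces the data of \<open>u\<close> to vanish.\<close>

lemma asymptotic_solution_c: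
  assumes t1: "tame V1" and t2: "tame V2"
    and W: "\<And>A. A > 0 \<Longrightarrow> (\<lambda>x. (V2 x - V1 x) * exp (A * x)) absolutely_integrable_on {0..}"
    and u: "solves_c V1 lam u u'"
  obtains v v' D where "solves_c V2 lam v v'" "\<And>x. x \<ge> 0 \<Longrightarrow> \<bar>u x - v x\<bar> \<le> D * exp (- x)"
    "u 0 \<noteq> 0 \<or> u' 0 \<noteq> 0 \<Longrightarrow> v 0 \<noteq> 0 \<or> v' 0 \<noteq> 0"
proof -
  obtain a1 a1' b1 b1' B1 C1 where basis1: "basis_c V1 lam a1 a1' b1 b1'" "B1 \<ge> 0"
    "\<forall>x\<ge>0. \<bar>a1 x\<bar> \<le> C1 * exp (B1 * x)" "\<forall>x\<ge>0. \<bar>a1' x\<bar> \<le> C1 * exp (B1 * x)"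
    "\<forall>x\<ge>0. \<bar>b1 x\<bar> \<le> C1 * exp (B1 * x)" "\<forall>x\<ge>0. \<bar>b1' x\<bar> \<le> C1 * exp (B1 * x)"
    using exists_basis_c[OF t1, of lam] .
  obtain a2 a2' b2 b2' B2 C2 where basis2: "basis_c V2 lam a2 a2' b2 b2'" "B2 \<ge> 0"
    "\<forall>x\<ge>0. \<bar>a2 x\<bar> \<le> C2 * exp (B2 * x)" "\<forall>x\<ge>0. \<bar>a2' x\<bar> \<le> C2 * exp (B2 * x)"
    "\<forall>x\<ge>0. \<bar>b2 x\<bar> \<le> C2 * exp (B2 * x)" "\<forall>x\<ge>0. \<bar>b2' x\<bar> \<le> C2 * exp (B2 * x)"
    using exists_basis_c[OF t2, of lam] .
  note b1 = basis1[rule_format] and b2 = basis2[rule_format]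
  interpret b1: basis_c V1 lam a1 a1' b1 b1' by (rule b1(1))
  interpret b2: basis_c V2 lam a2 a2' b2 b2' by (rule b2(1))
  define B where "B = max B1 B2"
  \<comment> \<open>\<open>C2\<close> bounds the basis for \<open>V2\<close>; the second term bounds
    \<open>u\<close> through its coordinates in the basis for \<open>V1\<close>.\<close>
  define C where "C = max C2 ((\<bar>u 0\<bar> + \<bar>u' 0\<bar>) * C1)"
  have B: "B \<ge> 0" "B1 \<le> B" "B2 \<le> B" using b1(2) by (auto simp: B_def)
  have C0: "C1 \<ge> 0" "C2 \<ge> 0"
    using b1(3)[of 0] b2(3)[of 0] by (auto simp: b1.init b2.init)
  have C: "C \<ge> 0" "C2 \<le> C" "(\<bar>u 0\<bar> + \<bar>u' 0\<bar>) * C1 \<le> C" using C0 by (auto simp: C_def le_max_iff_disj)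
  have g2: "y \<le> C * exp (B * x)" if "y \<le> C2 * exp (B2 * x)" "x \<ge> 0" for x y
  proof -
    have "C2 * exp (B2 * x) \<le> C * exp (B * x)" using B C C0 that by (intro mult_mono) (auto intro: mult_right_mono)
    with that show ?thesis by linarith
  qed
  have ga: "\<bar>a2 x\<bar> \<le> C * exp (B * x)" and ga': "\<bar>a2' x\<bar> \<le> C * exp (B * x)"
    and gb: "\<bar>b2 x\<bar> \<le> C * exp (B * x)" and gb': "\<bar>b2' x\<bar> \<le> C * exp (B * x)" if "x \<ge> 0" for x
    using g2 b2(3-6) that by blast+
  have gu: "\<bar>u x\<bar> \<le> C * exp (B * x)" if x: "x \<ge> 0" for x
  proof -
    have "\<bar>u x\<bar> \<le> \<bar>u 0\<bar> * \<bar>a1 x\<bar> + \<bar>u' 0\<bar> * \<bar>b1 x\<bar>"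
      unfolding b1.solution_eq(1)[OF u x] by (metis abs_mult abs_triangle_ineq)
    also have "\<dots> \<le> \<bar>u 0\<bar> * (C1 * exp (B1 * x)) + \<bar>u' 0\<bar> * (C1 * exp (B1 * x))"
      by (intro add_mono mult_left_mono b1 x) auto
    also have "\<dots> = (\<bar>u 0\<bar> + \<bar>u' 0\<bar>) * C1 * exp (B1 * x)" by (simp add: algebra_simps)
    also have "\<dots> \<le> C * exp (B * x)" using B C C0 x by (intro mult_mono) (auto intro: mult_right_mono)
    finally show ?thesis .
  qed
  define wa wb where "wa x = u x * a2' x - u' x * a2 x" and "wb x = u x * b2' x - u' x * b2 x" for x
  obtain a where a: "\<And>A. A > 0 \<Longrightarrow> \<exists>D. \<forall>x\<ge>0. \<bar>wa x - a\<bar> \<le> D * exp (- (A * x))"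
    using wronskian_limit_c[OF u b2.sol(1) W B(1) gu ga] unfolding wa_def by blast
  obtain b where b: "\<And>A. A > 0 \<Longrightarrow> \<exists>D. \<forall>x\<ge>0. \<bar>wb x - b\<bar> \<le> D * exp (- (A * x))"
    using wronskian_limit_c[OF u b2.sol(2) W B(1) gu gb] unfolding wb_def by blast
  have ueq: "u x = wb x * a2 x - wa x * b2 x" "u' x = wb x * a2' x - wa x * b2' x" if "x \<ge> 0" for x
  proof -
    have "u x = u x * (a2 x * b2' x - a2' x * b2 x)" "u' x = u' x * (a2 x * b2' x - a2' x * b2 x)"
      by (simp_all add: b2.wronskian_basis[OF that])
    then show "u x = wb x * a2 x - wa x * b2 x" "u' x = wb x * a2' x - wa x * b2' x"
      by (simp_all add: wa_def wb_def algebra_simps)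
  qed
  \<comment> \<open>Stated for general \<open>y\<close>, \<open>z\<close> in order to be used with
    \<open>a2\<close>, \<open>b2\<close> for \<open>u\<close> and with \<open>a2'\<close>,
    \<open>b2'\<close> for \<open>u'\<close>. The Wronskians are taken with rate
    \<open>A + B\<close>, of which \<open>B\<close> compensates the growth of \<open>y\<close> and
    \<open>z\<close>.\<close>
  have decay: "\<exists>D\<ge>0. \<forall>x\<ge>0. \<bar>(wb x - b) * y x - (wa x - a) * z x\<bar> \<le> D * exp (- (A * x))"
    if A: "A > 0" and yz: "\<And>x. x \<ge> 0 \<Longrightarrow> \<bar>y x\<bar> \<le> C * exp (B * x)" "\<And>x. x \<ge> 0 \<Longrightarrow> \<bar>z x\<bar> \<le> C * exp (B * x)"
    for A and y z :: "real \<Rightarrow> real"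
  proof -
    have AB: "A + B > 0" using A B by simp
    obtain Da Db where D: "\<forall>x\<ge>0. \<bar>wa x - a\<bar> \<le> Da * exp (- ((A + B) * x))" "\<forall>x\<ge>0. \<bar>wb x - b\<bar> \<le> Db * exp (- ((A + B) * x))"
      using a[OF AB] b[OF AB] by blast
    have D0: "Da \<ge> 0" "Db \<ge> 0" using D[rule_format, of 0] by auto
    have "\<bar>(wb x - b) * y x - (wa x - a) * z x\<bar> \<le> (Da + Db) * C * exp (- (A * x))" if x: "x \<ge> 0" for x
    proof -
      have "\<bar>(wb x - b) * y x - (wa x - a) * z x\<bar> \<le> \<bar>wb x - b\<bar> * \<bar>y x\<bar> + \<bar>wa x - a\<bar> * \<bar>z x\<bar>"
        by (metis abs_mult abs_triangle_ineq4)
      also have "\<dots> \<le> (Db * exp (- ((A + B) * x))) * (C * exp (B * x)) + (Da * exp (- ((A + B) * x))) * (C * exp (B * x))"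
        using D x yz[OF x] D0 by (intro add_mono mult_mono) auto
      also have "\<dots> = (Da + Db) * C * (exp (- ((A + B) * x)) * exp (B * x))" by (simp add: algebra_simps)
      also have "exp (- ((A + B) * x)) * exp (B * x) = exp (- (A * x))"
        by (simp add: algebra_simps flip: exp_add)
      finally show ?thesis .
    qed
    with D0 C show ?thesis by (intro exI[of _ "(Da + Db) * C"]) auto
  qed
  show thesis
  proof -
    obtain D where D: "\<forall>x\<ge>0. \<bar>(wb x - b) * a2 x - (wa x - a) * b2 x\<bar> \<le> D * exp (- (1 * x))"
      using decay[OF zero_less_one ga gb] by blast
    show thesis
    proof (rule that[of "\<lambda>x. b * a2 x + (- a) * b2 x" "\<lambda>x. b * a2' x + (- a) * b2' x" D])
      show "\<bar>u x - (b * a2 x + (- a) * b2 x)\<bar> \<le> D * exp (- x)" if "x \<ge> 0" for x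
        using D[rule_format, OF that] unfolding ueq(1)[OF that] by (simp add: algebra_simps)
    next
      assume nz: "u 0 \<noteq> 0 \<or> u' 0 \<noteq> 0"
      show "b * a2 0 + (- a) * b2 0 \<noteq> 0 \<or> b * a2' 0 + (- a) * b2' 0 \<noteq> 0"
      proof (rule ccontr)
        assume "\<not> ?thesis"
        then have ab: "a = 0" "b = 0" by (auto simp: b2.init)
        \<comment> \<open>Solutions for \<open>V1\<close> grow at rate at most
          \<open>B1 \<le> B\<close>, so their constant Wronskian with \<open>u\<close> is bounded by
          a multiple of \<open>exp (- x)\<close> and vanishes.\<close>
        define A where "A = B + 1"
        have A: "A > 0" using B by (simp add: A_def)
        obtain D1 where D1: "D1 \<ge> 0" "\<forall>x\<ge>0. \<bar>u x\<bar> \<le> D1 * exp (- (A * x))"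
          using decay[OF A ga gb] ueq(1) unfolding ab by (metis diff_0_right)
        obtain D2 where D2: "D2 \<ge> 0" "\<forall>x\<ge>0. \<bar>u' x\<bar> \<le> D2 * exp (- (A * x))"
          using decay[OF A ga' gb'] ueq(2) unfolding ab by (metis diff_0_right)
        have z: "u 0 * y' 0 - u' 0 * y 0 = 0"
          if y: "solves_c V1 lam y y'" "\<And>x. x \<ge> 0 \<Longrightarrow> \<bar>y x\<bar> \<le> C1 * exp (B1 * x)"
            "\<And>x. x \<ge> 0 \<Longrightarrow> \<bar>y' x\<bar> \<le> C1 * exp (B1 * x)" for y y'
        proof -
          have le: "\<bar>u 0 * y' 0 - u' 0 * y 0\<bar> \<le> (D1 + D2) * C1 * exp (- x)" if x: "x \<ge> 0" for x
          proof -
            have "\<bar>u 0 * y' 0 - u' 0 * y 0\<bar> = \<bar>u x * y' x - u' x * y x\<bar>"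
              using wronskian_const_c[OF u y(1) x] by simp
            also have "\<dots> \<le> \<bar>u x\<bar> * \<bar>y' x\<bar> + \<bar>u' x\<bar> * \<bar>y x\<bar>"
              by (metis abs_mult abs_triangle_ineq4)
            also have "\<dots> \<le> (D1 * exp (- (A * x))) * (C1 * exp (B1 * x)) + (D2 * exp (- (A * x))) * (C1 * exp (B1 * x))"
              using D1 D2 x y(2,3)[OF x] by (intro add_mono mult_mono) auto
            also have "\<dots> = (D1 + D2) * C1 * exp (- (A * x) + B1 * x)" by (simp only: exp_add) (simp add: algebra_simps)
            also have "\<dots> \<le> (D1 + D2) * C1 * exp (- x)"
              using D1 D2 C0 x B mult_right_mono[OF B(2) x] by (intro mult_left_mono) (auto simp: A_def algebra_simps)
            finally show ?thesis .
          qed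
          have "((\<lambda>x. (D1 + D2) * C1 * exp (- x)) \<longlongrightarrow> (D1 + D2) * C1 * 0) at_top"
            by (intro tendsto_mult_left filterlim_compose[OF exp_at_bot filterlim_uminus_at_bot_at_top])
          then have "\<bar>u 0 * y' 0 - u' 0 * y 0\<bar> \<le> (D1 + D2) * C1 * 0"
            by (rule tendsto_lowerbound) (use le in \<open>auto simp: eventually_at_top_linorder\<close>)
          then show ?thesis by simp
        qed
        \<comment> \<open>Pairing with the two basis solutions for \<open>V1\<close> isolates the
          two initial data of \<open>u\<close>.\<close>
        have "u' 0 = 0" "u 0 = 0"
          using z[OF b1.sol(1) b1(3,4)] z[OF b1.sol(2) b1(5,6)] by (simp_all add: b1.init)
        with nz show False by simp
      qed
    qed (rule b2.combination_solves)
  qed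
qed

lemma P_c_perturb:
  assumes t1: "tame V1" and t2: "tame V2"
    and W: "\<And>A. A > 0 \<Longrightarrow> (\<lambda>x. (V2 x - V1 x) * exp (A * x)) absolutely_integrable_on {0..}"
  shows "P_c V1 \<subseteq> P_c V2"
proof
  fix lam assume "lam \<in> P_c V1"
  then obtain u u' v v' where uv: "solves_c V1 lam u u'" "u 0 \<noteq> 0 \<or> u' 0 \<noteq> 0" "L2_c u"
    "solves_c V1 lam v v'" "\<not> L2_c v"
    unfolding P_c_iff[OF t1] by blast
  obtain p p' D where p: "solves_c V2 lam p p'" "\<And>x. x \<ge> 0 \<Longrightarrow> \<bar>u x - p x\<bar> \<le> D * exp (- x)"
    "u 0 \<noteq> 0 \<or> u' 0 \<noteq> 0 \<Longrightarrow> p 0 \<noteq> 0 \<or> p' 0 \<noteq> 0"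
    using asymptotic_solution_c[OF t1 t2 W uv(1)] by blast
  obtain r r' E where r: "solves_c V2 lam r r'" "\<And>x. x \<ge> 0 \<Longrightarrow> \<bar>v x - r x\<bar> \<le> E * exp (- x)"
    using asymptotic_solution_c[OF t1 t2 W uv(4)] by blast
  have "L2_c p"
    by (rule L2_c_perturb[OF solves_c_continuous(1)[OF uv(1)] solves_c_continuous(1)[OF p(1)] p(2) uv(3)])
  \<comment> \<open>Perturbation is applied backwards: if \<open>r\<close> were square-integrable,
    so would be \<open>v\<close>.\<close>
  moreover have "\<not> L2_c r"
    using L2_c_perturb[OF solves_c_continuous(1)[OF r(1)] solves_c_continuous(1)[OF uv(4)], of E] r(2) uv(5)
    by (auto simp: abs_minus_commute)
  ultimately show "lam \<in> P_c V2"
    unfolding P_c_iff[OF t2] using p(1,3) uv(2) r(1) by blast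
qed

lemma P_c_eq:
  assumes V0: "potential_c V0" "bounded_c V0" and W: "potential_c W"
    and decay: "\<And>A. A > 0 \<Longrightarrow> (\<lambda>x. \<bar>W x\<bar> * exp (A * \<bar>x\<bar>)) absolutely_integrable_on {0..}"
  shows "P_c V0 = P_c (\<lambda>x. V0 x + W x)"
proof -
  \<comment> \<open>The sign \<open>c\<close> covers both inclusions, where \<open>V2 - V1\<close>
    is \<open>W\<close> or \<open>- W\<close>.\<close>
  have W1: "(\<lambda>x. c * W x * exp (A * x)) absolutely_integrable_on {0..}" if "A > 0" "\<bar>c\<bar> = 1" for A c
  proof (rule absolutely_integrable_Ici_bound)
    show "(\<lambda>x. \<bar>W x\<bar> * exp (A * \<bar>x\<bar>)) integrable_on {0..}"
      using decay[OF that(1)] by (simp add: absolutely_integrable_on_def)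
    have "continuous_on {0..} (\<lambda>x. c * exp (A * x))" by (intro continuous_intros)
    from potential_c_continuous_mult[OF W this]
    show "(\<lambda>x. c * W x * exp (A * x)) integrable_on {0..b}" if "b \<ge> 0" for b
      using that by (simp add: absolutely_integrable_on_def mult_ac)
  qed (use that in \<open>auto simp: abs_mult\<close>)
  have "(\<lambda>x. \<bar>W x\<bar>) absolutely_integrable_on {0..}"
  proof (rule absolutely_integrable_Ici_bound)
    show "(\<lambda>x. \<bar>W x\<bar> * exp (1 * \<bar>x\<bar>)) integrable_on {0..}"
      using decay[of 1] by (simp add: absolutely_integrable_on_def)
    show "(\<lambda>x. \<bar>W x\<bar>) integrable_on {0..b}" if "b \<ge> 0" for b
      using W that by (simp add: potential_c_def absolutely_integrable_on_def)
    show "\<bar>\<bar>W x\<bar>\<bar> \<le> \<bar>W x\<bar> * exp (1 * \<bar>x\<bar>)" for x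
      by (simp add: mult_le_cancel_left1)
  qed
  then have "tame W" by (intro tame_integrable W) (simp add: absolutely_integrable_on_def)
  moreover have "tame V0" using V0 by (rule tame_bounded)
  ultimately have t: "tame V0" "tame (\<lambda>x. V0 x + W x)" by (auto intro: tame_add)
  show ?thesis
  proof
    show "P_c V0 \<subseteq> P_c (\<lambda>x. V0 x + W x)"
      using W1[of _ 1] by (intro P_c_perturb t) simp
    show "P_c (\<lambda>x. V0 x + W x) \<subseteq> P_c V0"
      using W1[of _ "- 1"] by (intro P_c_perturb t) simp
  qed
qed

section \<open>The discrete case\<close>

text \<open>The index shift removes the truncated subtraction \<open>n - 1\<close> and gives the
  form of a two-step recursion.\<close>

lemma solves_d_iff:
  "solves_d V lam u \<longleftrightarrow> (\<forall>n. u (Suc (Suc n)) = (lam - V (Suc n)) * u (Suc n) - u n)"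
proof -
  have "solves_d V lam u \<longleftrightarrow> (\<forall>n. u (Suc n + 1) + u (Suc n - 1) + V (Suc n) * u (Suc n) = lam * u (Suc n))"
    unfolding solves_d_def by (metis Suc_le_D le_add1 plus_1_eq_Suc One_nat_def)
  also have "\<dots> \<longleftrightarrow> (\<forall>n. u (Suc (Suc n)) = (lam - V (Suc n)) * u (Suc n) - u n)"
    by (intro all_cong1) (auto simp: algebra_simps)
  finally show ?thesis .
qed

fun sol_d :: "(nat \<Rightarrow> real) \<Rightarrow> real \<Rightarrow> real \<Rightarrow> real \<Rightarrow> nat \<Rightarrow> real" where
  "sol_d V lam a b 0 = a"
| "sol_d V lam a b (Suc 0) = b"
| "sol_d V lam a b (Suc (Suc n)) = (lam - V (Suc n)) * sol_d V lam a b (Suc n) - sol_d V lam a b n"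

lemma solves_d_linear:
  "solves_d V lam u \<Longrightarrow> solves_d V lam v \<Longrightarrow> solves_d V lam (\<lambda>n. a * u n + b * v n)"
  unfolding solves_d_iff by (simp, simp add: algebra_simps)

text \<open>Summation by parts in one step. The sign of the potential difference is opposite to the
  continuum, because \<open>V\<close> enters the recursion with a minus.\<close>

lemma wronskian_step_d:
  assumes "solves_d V1 lam u" "solves_d V2 lam v"
  shows "u (Suc n) * v (Suc (Suc n)) - u (Suc (Suc n)) * v (Suc n) =
    u n * v (Suc n) - u (Suc n) * v n + (V1 (Suc n) - V2 (Suc n)) * u (Suc n) * v (Suc n)"
proof -
  have "u (Suc (Suc n)) = (lam - V1 (Suc n)) * u (Suc n) - u n"
    "v (Suc (Suc n)) = (lam - V2 (Suc n)) * v (Suc n) - v n"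
    using assms unfolding solves_d_iff by blast+
  then show ?thesis by (simp only:) (simp add: algebra_simps)
qed

lemma wronskian_const_d:
  assumes "solves_d V lam u" "solves_d V lam v"
  shows "u n * v (Suc n) - u (Suc n) * v n = u 0 * v 1 - u 1 * v 0"
  by (induction n) (simp_all add: wronskian_step_d[OF assms])

definition L2_d :: "(nat \<Rightarrow> real) \<Rightarrow> bool" where
  "L2_d u \<longleftrightarrow> (\<lambda>n. \<bar>u n\<bar>\<^sup>2) summable_on {1..}"

lemma normL_d_squared_nonneg:
  "0 \<le> (\<Sum>n = 1..nat \<lfloor>L\<rfloor>. \<bar>u n\<bar>\<^sup>2) + (L - of_int \<lfloor>L\<rfloor>) * \<bar>u (nat \<lfloor>L\<rfloor> + 1)\<bar>\<^sup>2" for L :: real and u :: "nat \<Rightarrow> real"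
  by (intro add_nonneg_nonneg sum_nonneg mult_nonneg_nonneg) auto

lemma normL_d_le_sum:
  "(\<Sum>n = 1..nat \<lfloor>L\<rfloor>. \<bar>u n\<bar>\<^sup>2) + (L - of_int \<lfloor>L\<rfloor>) * \<bar>u (nat \<lfloor>L\<rfloor> + 1)\<bar>\<^sup>2 \<le> (\<Sum>n = 1..nat \<lfloor>L\<rfloor> + 1. \<bar>u n\<bar>\<^sup>2)"
  for L :: real and u :: "nat \<Rightarrow> real"
proof -
  have "(L - of_int \<lfloor>L\<rfloor>) * \<bar>u (nat \<lfloor>L\<rfloor> + 1)\<bar>\<^sup>2 \<le> 1 * \<bar>u (nat \<lfloor>L\<rfloor> + 1)\<bar>\<^sup>2"
    by (rule mult_right_mono) (linarith, simp)
  then show ?thesis by simp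
qed

lemma normL_d_mono:
  assumes "0 \<le> L" "L \<le> M"
  shows "normL_d L u \<le> normL_d M u"
  unfolding normL_d_def
proof (rule real_sqrt_le_mono)
  \<comment> \<open>Either only the fractional weight grows, or the site counted partially for
    \<open>L\<close> is counted fully for \<open>M\<close>.\<close>
  consider "\<lfloor>L\<rfloor> = \<lfloor>M\<rfloor>" | "nat \<lfloor>L\<rfloor> + 1 \<le> nat \<lfloor>M\<rfloor>"
    using assms floor_mono[OF assms(2)] by linarith
  then show "(\<Sum>n = 1..nat \<lfloor>L\<rfloor>. \<bar>u n\<bar>\<^sup>2) + (L - of_int \<lfloor>L\<rfloor>) * \<bar>u (nat \<lfloor>L\<rfloor> + 1)\<bar>\<^sup>2 \<le>
    (\<Sum>n = 1..nat \<lfloor>M\<rfloor>. \<bar>u n\<bar>\<^sup>2) + (M - of_int \<lfloor>M\<rfloor>) * \<bar>u (nat \<lfloor>M\<rfloor> + 1)\<bar>\<^sup>2"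
  proof cases
    case 1
    then show ?thesis using assms by (auto intro!: mult_right_mono)
  next
    case 2
    have "(\<Sum>n = 1..nat \<lfloor>L\<rfloor> + 1. \<bar>u n\<bar>\<^sup>2) \<le> (\<Sum>n = 1..nat \<lfloor>M\<rfloor>. \<bar>u n\<bar>\<^sup>2)"
      using 2 by (intro sum_mono2) auto
    moreover have "0 \<le> (M - of_int \<lfloor>M\<rfloor>) * \<bar>u (nat \<lfloor>M\<rfloor> + 1)\<bar>\<^sup>2"
      by (intro mult_nonneg_nonneg) auto
    ultimately show ?thesis using normL_d_le_sum[of u L] by linarith
  qed
qed

lemma L2_d_iff_bounded: "L2_d u \<longleftrightarrow> (\<exists>C. \<forall>L\<ge>0. normL_d L u \<le> C)"
proof
  assume "L2_d u"
  then have s: "(\<lambda>n. \<bar>u n\<bar>\<^sup>2) summable_on {1..}" by (simp add: L2_d_def)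
  have "normL_d L u \<le> sqrt (infsum (\<lambda>n. \<bar>u n\<bar>\<^sup>2) {1..})" for L
    unfolding normL_d_def
    by (intro real_sqrt_le_mono order.trans[OF normL_d_le_sum] finite_sum_le_infsum[OF s]) auto
  then show "\<exists>C. \<forall>L\<ge>0. normL_d L u \<le> C" by blast
next
  assume "\<exists>C. \<forall>L\<ge>0. normL_d L u \<le> C"
  then obtain C where C: "\<And>L. L \<ge> 0 \<Longrightarrow> normL_d L u \<le> C" by blast
  have le: "(\<Sum>n = 1..N. \<bar>u n\<bar>\<^sup>2) \<le> C\<^sup>2" for N
    using C[of "real N"] unfolding normL_d_def by (simp add: sqrt_le_D)
  have "sum (\<lambda>n. \<bar>u n\<bar>\<^sup>2) F \<le> C\<^sup>2" if F: "F \<subseteq> {1..}" "finite F" for F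
  proof -
    have "F \<subseteq> {1..Max F}" using F by auto
    then have "sum (\<lambda>n. \<bar>u n\<bar>\<^sup>2) F \<le> (\<Sum>n = 1..Max F. \<bar>u n\<bar>\<^sup>2)" by (intro sum_mono2) auto
    with le[of "Max F"] show ?thesis by linarith
  qed
  then show "L2_d u" unfolding L2_d_def
    by (intro nonneg_bdd_above_summable_on bdd_aboveI2[where M = "C\<^sup>2"]) auto
qed

lemma L2_d_perturb:
  assumes "L2_d u" "\<And>n. \<bar>u n - v n\<bar> \<le> C * (1 / 2) ^ n"
  shows "L2_d v"
  unfolding L2_d_def
proof (rule summable_on_comparison_test)
  have "summable (\<lambda>n. norm ((1 / 4 :: real) ^ n))" by (simp add: summable_geometric)
  then have "(\<lambda>n. (1 / 4 :: real) ^ n) summable_on UNIV" by (rule norm_summable_imp_summable_on)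
  then have "(\<lambda>n. (1 / 4 :: real) ^ n) summable_on {1..}" by (rule summable_on_subset_banach) simp
  then show "(\<lambda>n. 2 * \<bar>u n\<bar>\<^sup>2 + 2 * C\<^sup>2 * (1 / 4) ^ n) summable_on {1..}"
    using assms(1) unfolding L2_d_def by (intro summable_on_add summable_on_cmult_right)
  show "\<bar>v n\<bar>\<^sup>2 \<le> 2 * \<bar>u n\<bar>\<^sup>2 + 2 * C\<^sup>2 * (1 / 4) ^ n" for n
  proof -
    have "(v n)\<^sup>2 + (2 * u n - v n)\<^sup>2 = 2 * (u n)\<^sup>2 + 2 * (u n - v n)\<^sup>2"
      by (simp add: power2_eq_square algebra_simps)
    then have "(v n)\<^sup>2 \<le> 2 * (u n)\<^sup>2 + 2 * (u n - v n)\<^sup>2"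
      by (metis le_add_same_cancel1 zero_le_power2)
    moreover have "(u n - v n)\<^sup>2 \<le> (C * (1 / 2) ^ n)\<^sup>2"
      using power_mono[OF assms(2) abs_ge_zero, of n 2] by simp
    moreover have "(C * (1 / 2) ^ n)\<^sup>2 = C\<^sup>2 * (1 / 4) ^ n"
      by (simp add: power_mult_distrib power2_eq_square flip: power_mult_distrib)
    ultimately show ?thesis by simp
  qed
qed auto

section \<open>Discrete fundamental systems and the description of \<open>P_d\<close>\<close>

locale basis_d =
  fixes V :: "nat \<Rightarrow> real" and lam :: real and al be :: "nat \<Rightarrow> real"
  assumes sol: "solves_d V lam al" "solves_d V lam be"
    and init: "al 0 = 1" "al (Suc 0) = 0" "be 0 = 0" "be (Suc 0) = 1"
begin

lemma wronskian_basis: "al n * be (Suc n) - al (Suc n) * be n = 1"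
  using wronskian_const_d[OF sol] by (simp add: init)

lemma combination_solves: "solves_d V lam (\<lambda>n. a * al n + b * be n)"
  by (rule solves_d_linear[OF sol])

lemma solution_eq:
  assumes "solves_d V lam u"
  shows "u = (\<lambda>n. u 0 * al n + u 1 * be n)"
proof
  fix n
  have "u n = u n * (al n * be (Suc n) - al (Suc n) * be n)" by (simp add: wronskian_basis)
  also have "\<dots> = (u n * be (Suc n) - u (Suc n) * be n) * al n - (u n * al (Suc n) - u (Suc n) * al n) * be n"
    by (simp add: algebra_simps)
  also have "\<dots> = u 0 * al n + u 1 * be n"
    unfolding wronskian_const_d[OF assms sol(1)] wronskian_const_d[OF assms sol(2)] by (simp add: init)
  finally show "u n = u 0 * al n + u 1 * be n" .
qed

lemma phi1_d_eq: "phi1_d V \<theta> lam = (\<lambda>n. sin \<theta> * al n + - cos \<theta> * be n)"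
  unfolding phi1_d_def
proof (rule the_equality)
  show "solves_d V lam (\<lambda>n. sin \<theta> * al n + - cos \<theta> * be n) \<and>
      sin \<theta> * al 0 + - cos \<theta> * be 0 = sin \<theta> \<and> sin \<theta> * al 1 + - cos \<theta> * be 1 = - cos \<theta>"
    using combination_solves[of "sin \<theta>" "- cos \<theta>"] by (simp add: init)
qed (use solution_eq in metis)

sublocale solution_norms "\<lambda>L a b. normL_d L (\<lambda>n. a * al n + b * be n)"
proof
  fix L M a b c d r :: real
  show "0 \<le> normL_d L (\<lambda>n. a * al n + b * be n)"
    unfolding normL_d_def by (intro real_sqrt_ge_zero normL_d_squared_nonneg)
  show "normL_d L (\<lambda>n. (a + c) * al n + (b + d) * be n) \<le>
      2 * (normL_d L (\<lambda>n. a * al n + b * be n) + normL_d L (\<lambda>n. c * al n + d * be n))"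
  proof -
    define Q where "Q u = (\<Sum>n = 1..nat \<lfloor>L\<rfloor>. \<bar>u n\<bar>\<^sup>2) + (L - of_int \<lfloor>L\<rfloor>) * \<bar>u (nat \<lfloor>L\<rfloor> + 1)\<bar>\<^sup>2" for u :: "nat \<Rightarrow> real"
    define s t where "s = Q (\<lambda>n. a * al n + b * be n)" and "t = Q (\<lambda>n. c * al n + d * be n)"
    have st: "s \<ge> 0" "t \<ge> 0" unfolding s_def t_def Q_def by (rule normL_d_squared_nonneg)+
    have *: "\<bar>(a + c) * x + (b + d) * y\<bar>\<^sup>2 \<le> 2 * \<bar>a * x + b * y\<bar>\<^sup>2 + 2 * \<bar>c * x + d * y\<bar>\<^sup>2" for x y
    proof -
      have "((a + c) * x + (b + d) * y)\<^sup>2 + ((a - c) * x + (b - d) * y)\<^sup>2 =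
          2 * (a * x + b * y)\<^sup>2 + 2 * (c * x + d * y)\<^sup>2"
        by (simp add: power2_eq_square algebra_simps)
      then show ?thesis unfolding power2_abs by (metis le_add_same_cancel1 zero_le_power2)
    qed
    have "Q (\<lambda>n. (a + c) * al n + (b + d) * be n) \<le>
      (\<Sum>n = 1..nat \<lfloor>L\<rfloor>. 2 * \<bar>a * al n + b * be n\<bar>\<^sup>2 + 2 * \<bar>c * al n + d * be n\<bar>\<^sup>2) +
      (L - of_int \<lfloor>L\<rfloor>) * (2 * \<bar>a * al (nat \<lfloor>L\<rfloor> + 1) + b * be (nat \<lfloor>L\<rfloor> + 1)\<bar>\<^sup>2 + 2 * \<bar>c * al (nat \<lfloor>L\<rfloor> + 1) + d * be (nat \<lfloor>L\<rfloor> + 1)\<bar>\<^sup>2)"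
      unfolding Q_def by (intro add_mono sum_mono mult_left_mono *) auto
    also have "\<dots> = 2 * s + 2 * t"
      unfolding s_def t_def Q_def by (simp add: sum.distrib sum_distrib_left algebra_simps del: power2_abs)
    also have "\<dots> \<le> (2 * (sqrt s + sqrt t))\<^sup>2"
      using st by (simp add: power2_sum power_mult_distrib)
    finally have "sqrt (Q (\<lambda>n. (a + c) * al n + (b + d) * be n)) \<le> 2 * (sqrt s + sqrt t)"
      using st by (intro real_le_lsqrt) auto
    then show ?thesis by (simp add: normL_d_def s_def t_def Q_def)
  qed
  show "normL_d L (\<lambda>n. r * a * al n + r * b * be n) = \<bar>r\<bar> * normL_d L (\<lambda>n. a * al n + b * be n)"
  proof -
    have *: "\<bar>r * a * x + r * b * y\<bar>\<^sup>2 = r\<^sup>2 * \<bar>a * x + b * y\<bar>\<^sup>2" for x y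
      by (simp add: power_mult_distrib[symmetric] algebra_simps)
    have "\<bar>r\<bar> = sqrt (r\<^sup>2)" by simp
    then show ?thesis
      unfolding normL_d_def * by (simp only: real_sqrt_mult[symmetric]) (simp add: sum_distrib_left algebra_simps del: power2_abs)
  qed
  show "0 \<le> L \<Longrightarrow> L \<le> M \<Longrightarrow> normL_d L (\<lambda>n. a * al n + b * be n) \<le> normL_d M (\<lambda>n. a * al n + b * be n)"
    by (rule normL_d_mono)
  show "\<exists>L\<ge>0. 0 < normL_d L (\<lambda>n. a * al n + b * be n)" if "a \<noteq> 0 \<or> b \<noteq> 0"
  \<comment> \<open>Site 0 is outside the norm and site 1 sees only \<open>b\<close>, so two sites
    are taken: the value \<open>b * (lam - V 1) - a\<close> at site 2 detects \<open>a\<close> once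
    \<open>b\<close> is 0.\<close>
  proof (intro exI[of _ 2] conjI)
    have "al 2 = - 1" using sol(1) unfolding solves_d_iff by (simp add: numeral_2_eq_2 init)
    moreover have "be 2 = lam - V 1" using sol(2) unfolding solves_d_iff by (simp add: numeral_2_eq_2 init)
    moreover have "{1..2} = {1, 2::nat}" by auto
    ultimately have "normL_d 2 (\<lambda>n. a * al n + b * be n) = sqrt (b\<^sup>2 + (b * (lam - V 1) - a)\<^sup>2)"
      by (simp add: normL_d_def init)
    also have "\<dots> > 0" using that by (auto simp: sum_power2_gt_zero_iff)
    finally show "0 < normL_d 2 (\<lambda>n. a * al n + b * be n)" .
  qed simp
qed

lemma P_d_iff:
  "lam \<in> P_d V \<longleftrightarrow>
    (\<exists>u. solves_d V lam u \<and> (u 0 \<noteq> 0 \<or> u 1 \<noteq> 0) \<and> L2_d u) \<and> (\<exists>u. solves_d V lam u \<and> \<not> L2_d u)"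
proof -
  have sub: "subordinate_d V lam \<theta> \<longleftrightarrow> sub \<theta>" for \<theta>
    unfolding subordinate_d_def sub_def phi2_d_def phi1_d_eq ..
  have bd: "bd a b \<longleftrightarrow> L2_d (\<lambda>n. a * al n + b * be n)" for a b
    unfolding bd_def L2_d_iff_bounded ..
  have L2: "L2_d u \<longleftrightarrow> bd (u 0) (u 1)" if "solves_d V lam u" for u
    unfolding bd using solution_eq[OF that] by metis
  have "lam \<in> P_d V \<longleftrightarrow> (\<exists>\<theta>\<in>{0..<pi}. sub \<theta>) \<and>
     bd (sin (THE \<theta>. \<theta> \<in> {0..<pi} \<and> sub \<theta>)) (- cos (THE \<theta>. \<theta> \<in> {0..<pi} \<and> sub \<theta>))"
    by (simp add: P_d_def theta_d_def sub phi1_d_eq bd L2_d_def)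
  also have "\<dots> \<longleftrightarrow> (\<exists>a b. (a \<noteq> 0 \<or> b \<noteq> 0) \<and> bd a b) \<and> (\<exists>a b. \<not> bd a b)"
    by (rule sub_bd_iff)
  also have "(\<exists>a b. (a \<noteq> 0 \<or> b \<noteq> 0) \<and> bd a b) \<longleftrightarrow> (\<exists>u. solves_d V lam u \<and> (u 0 \<noteq> 0 \<or> u 1 \<noteq> 0) \<and> L2_d u)"
    (is "?l1 \<longleftrightarrow> ?r1")
  proof
    assume ?l1
    then obtain a b where ab: "a \<noteq> 0 \<or> b \<noteq> 0" "bd a b" by blast
    then show ?r1 using combination_solves[of a b]
      by (intro exI[of _ "\<lambda>n. a * al n + b * be n"]) (auto simp: bd init)
  qed (use L2 in blast)
  also have "(\<exists>a b. \<not> bd a b) \<longleftrightarrow> (\<exists>u. solves_d V lam u \<and> \<not> L2_d u)"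
    using L2 combination_solves bd by blast
  finally show ?thesis .
qed

end

lemma basis_d_sol_d: "basis_d V lam (sol_d V lam 1 0) (sol_d V lam 0 1)"
  by unfold_locales (simp_all add: solves_d_iff)

lemmas P_d_iff = basis_d.P_d_iff[OF basis_d_sol_d]

section \<open>Growth, Wronskian limits and transfer of solutions in the discrete case\<close>

lemma growth_d:
  assumes "bounded (V ` {1..})"
  obtains R where "R \<ge> 1" "\<And>u n. solves_d V lam u \<Longrightarrow> \<bar>u n\<bar> \<le> (\<bar>u 0\<bar> + \<bar>u 1\<bar>) * R ^ n"
proof -
  obtain K where K: "K > 0" "\<And>n. n \<ge> 1 \<Longrightarrow> \<bar>V n\<bar> \<le> K" using assms unfolding bounded_pos by auto
  \<comment> \<open>One recursion step contributes at most the factor \<open>R - 1\<close> from the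
    current value plus 1 from the previous one. The induction carries two consecutive values, and
    \<open>R\<close> is independent of the solution.\<close>
  define R where "R = \<bar>lam\<bar> + K + 1"
  have R: "R \<ge> 1" using K by (simp add: R_def)
  have "\<bar>u n\<bar> \<le> (\<bar>u 0\<bar> + \<bar>u 1\<bar>) * R ^ n \<and> \<bar>u (Suc n)\<bar> \<le> (\<bar>u 0\<bar> + \<bar>u 1\<bar>) * R ^ Suc n"
    if u: "solves_d V lam u" for u n
  proof (induction n)
    case 0
    have "(\<bar>u 0\<bar> + \<bar>u 1\<bar>) * 1 \<le> (\<bar>u 0\<bar> + \<bar>u 1\<bar>) * R" using R by (intro mult_left_mono) auto
    then show ?case by simp
  next
    case (Suc n)
    define C where "C = \<bar>u 0\<bar> + \<bar>u 1\<bar>"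
    have V: "\<bar>lam - V (Suc n)\<bar> \<le> R - 1" using K(2)[of "Suc n"] by (simp add: R_def)
    have "\<bar>u (Suc (Suc n))\<bar> = \<bar>(lam - V (Suc n)) * u (Suc n) - u n\<bar>" using u by (simp add: solves_d_iff)
    also have "\<dots> \<le> \<bar>lam - V (Suc n)\<bar> * \<bar>u (Suc n)\<bar> + \<bar>u n\<bar>"
      by (metis abs_mult abs_triangle_ineq4)
    also have "\<dots> \<le> (R - 1) * (C * R ^ Suc n) + C * R ^ Suc n"
    proof (intro add_mono mult_mono V)
      have "C * R ^ n \<le> C * R ^ Suc n" using R by (intro mult_left_mono power_increasing) (auto simp: C_def)
      then show "\<bar>u n\<bar> \<le> C * R ^ Suc n" using Suc by (simp add: C_def)
    qed (use R Suc in \<open>auto simp: C_def\<close>)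
    also have "\<dots> = C * R ^ Suc (Suc n)" by (simp add: algebra_simps)
    finally show ?case using Suc by (simp add: C_def)
  qed
  with R that show thesis by blast
qed

text \<open>For \<open>k \<ge> n\<close> the factor \<open>\<rho> ^ k / \<rho> ^ n\<close> is at
  least 1, so the tail of \<open>h\<close> from \<open>n\<close> on is at most the weighted series
  divided by \<open>\<rho> ^ n\<close>. As in the continuum, the limit is fixed before
  \<open>\<rho>\<close>.\<close>

lemma geometric_tail_limit:
  fixes w h :: "nat \<Rightarrow> real"
  assumes step: "\<And>n. \<bar>w (Suc n) - w n\<bar> \<le> h n" and h: "\<And>\<rho>. \<rho> > 1 \<Longrightarrow> summable (\<lambda>n. h n * \<rho> ^ n)"
  shows "\<exists>l. \<forall>\<rho>>1. \<exists>D. \<forall>n. \<bar>w n - l\<bar> \<le> D / \<rho> ^ n"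
proof -
  have h0: "h n \<ge> 0" for n using step[of n] by linarith
  have "summable h"
  proof (rule summable_comparison_test'[OF h[of 2]])
    show "norm (h n) \<le> h n * 2 ^ n" for n using h0[of n] by (simp add: mult_le_cancel_left1)
  qed simp
  then have "summable (\<lambda>n. w (Suc n) - w n)"
    by (rule summable_comparison_test') (use step in auto)
  then have "convergent (\<lambda>n. w n - w 0)"
    by (simp add: summable_iff_convergent sum_lessThan_telescope)
  then have "convergent (\<lambda>n. (w n - w 0) + w 0)" by (rule convergent_add) (rule convergent_const)
  then have "convergent w" by simp
  then obtain l where l: "w \<longlonglongrightarrow> l" by (auto simp: convergent_def)
  have "\<bar>w n - l\<bar> \<le> (\<Sum>k. h k * \<rho> ^ k) / \<rho> ^ n" if \<rho>: "\<rho> > 1" for \<rho> n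
  proof -
    have fin: "\<bar>w m - w n\<bar> \<le> (\<Sum>k. h k * \<rho> ^ k) / \<rho> ^ n" if "n \<le> m" for m
    proof -
      have "\<bar>w m - w n\<bar> = \<bar>\<Sum>k = n..<m. w (Suc k) - w k\<bar>" using that by (simp add: sum_Suc_diff')
      also have "\<dots> \<le> (\<Sum>k = n..<m. h k)" by (rule sum_norm_le[of _ "\<lambda>k. w (Suc k) - w k", simplified]) (rule step)
      also have "\<dots> \<le> (\<Sum>k = n..<m. h k * \<rho> ^ k / \<rho> ^ n)"
      proof (rule sum_mono)
        fix k assume "k \<in> {n..<m}"
        then have "\<rho> ^ n \<le> \<rho> ^ k" using \<rho> by (intro power_increasing) auto
        then have "h k * \<rho> ^ n \<le> h k * \<rho> ^ k" using h0 by (intro mult_left_mono)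
        then show "h k \<le> h k * \<rho> ^ k / \<rho> ^ n" using \<rho> by (simp add: field_simps)
      qed
      also have "\<dots> = (\<Sum>k = n..<m. h k * \<rho> ^ k) / \<rho> ^ n" by (simp add: sum_divide_distrib)
      also have "\<dots> \<le> (\<Sum>k. h k * \<rho> ^ k) / \<rho> ^ n"
        using \<rho> h0 by (intro divide_right_mono sum_le_suminf h) auto
      finally show ?thesis .
    qed
    have "(\<lambda>m. \<bar>w m - w n\<bar>) \<longlonglongrightarrow> \<bar>l - w n\<bar>" by (intro tendsto_intros l)
    then have "\<bar>l - w n\<bar> \<le> (\<Sum>k. h k * \<rho> ^ k) / \<rho> ^ n"
      by (rule tendsto_upperbound) (use fin in \<open>auto simp: eventually_sequentially\<close>)
    then show ?thesis by (simp add: abs_minus_commute)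
  qed
  then show ?thesis by blast
qed

lemma wronskian_limit_d:
  assumes u: "solves_d V1 lam u" and v: "solves_d V2 lam v" and R: "R \<ge> 1"
    and W: "\<And>\<rho>. \<rho> > 1 \<Longrightarrow> summable (\<lambda>n. \<bar>V2 (Suc n) - V1 (Suc n)\<bar> * \<rho> ^ n)"
    and gu: "\<And>n. \<bar>u n\<bar> \<le> C * R ^ n" and gv: "\<And>n. \<bar>v n\<bar> \<le> C * R ^ n"
  shows "\<exists>w. \<forall>\<rho>>1. \<exists>D. \<forall>n. \<bar>(u n * v (Suc n) - u (Suc n) * v n) - w\<bar> \<le> D / \<rho> ^ n"
proof (rule geometric_tail_limit)
  fix n
  have "(u (Suc n) * v (Suc (Suc n)) - u (Suc (Suc n)) * v (Suc n)) - (u n * v (Suc n) - u (Suc n) * v n)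
      = (V1 (Suc n) - V2 (Suc n)) * (u (Suc n) * v (Suc n))"
    using wronskian_step_d[OF u v, of n] by simp
  also have "\<bar>\<dots>\<bar> = \<bar>V2 (Suc n) - V1 (Suc n)\<bar> * (\<bar>u (Suc n)\<bar> * \<bar>v (Suc n)\<bar>)"
    by (simp add: abs_mult abs_minus_commute)
  also have "\<dots> \<le> \<bar>V2 (Suc n) - V1 (Suc n)\<bar> * ((C * R ^ Suc n) * (C * R ^ Suc n))"
    using gu[of "Suc n"] gv[of "Suc n"] by (intro mult_left_mono mult_mono) auto
  finally show "\<bar>(u (Suc n) * v (Suc (Suc n)) - u (Suc (Suc n)) * v (Suc n)) - (u n * v (Suc n) - u (Suc n) * v n)\<bar>
      \<le> \<bar>V2 (Suc n) - V1 (Suc n)\<bar> * ((C * R ^ Suc n) * (C * R ^ Suc n))" .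
next
  fix \<rho> :: real assume \<rho>: "\<rho> > 1"
  \<comment> \<open>Two solutions together grow by \<open>R * R\<close> per step, so the decay
    hypothesis is invoked at rate \<open>R * R * \<rho>\<close>.\<close>
  have "1 * 1 < R * R * \<rho>" using R \<rho> mult_mono[OF R R] by (intro mult_le_less_imp_less) auto
  then have "summable (\<lambda>n. C * C * R * R * (\<bar>V2 (Suc n) - V1 (Suc n)\<bar> * (R * R * \<rho>) ^ n))"
    by (intro summable_mult W) simp
  then show "summable (\<lambda>n. \<bar>V2 (Suc n) - V1 (Suc n)\<bar> * ((C * R ^ Suc n) * (C * R ^ Suc n)) * \<rho> ^ n)"
    by (simp add: power_mult_distrib ac_simps)
qed

text \<open>Same construction as in the continuum. The discrete Wronskian involves consecutive
  values of \<open>u\<close> itself, so decay of \<open>u\<close> alone yields injectivity.\<close>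

lemma asymptotic_solution_d:
  assumes bd1: "bounded (V1 ` {1..})" and bd2: "bounded (V2 ` {1..})"
    and W: "\<And>\<rho>. \<rho> > 1 \<Longrightarrow> summable (\<lambda>n. \<bar>V2 (Suc n) - V1 (Suc n)\<bar> * \<rho> ^ n)"
    and u: "solves_d V1 lam u"
  obtains v D where "solves_d V2 lam v" "\<And>n. \<bar>u n - v n\<bar> \<le> D * (1 / 2) ^ n"
    "u 0 \<noteq> 0 \<or> u 1 \<noteq> 0 \<Longrightarrow> v 0 \<noteq> 0 \<or> v 1 \<noteq> 0"
proof -
  interpret b1: basis_d V1 lam "sol_d V1 lam 1 0" "sol_d V1 lam 0 1" by (rule basis_d_sol_d)
  define a2 b2 where "a2 = sol_d V2 lam 1 0" and "b2 = sol_d V2 lam 0 1"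
  interpret b2: basis_d V2 lam a2 b2 unfolding a2_def b2_def by (rule basis_d_sol_d)
  obtain R1 where R1: "R1 \<ge> 1" "\<And>u n. solves_d V1 lam u \<Longrightarrow> \<bar>u n\<bar> \<le> (\<bar>u 0\<bar> + \<bar>u 1\<bar>) * R1 ^ n"
    using growth_d[OF bd1, of lam] by blast
  obtain R2 where R2: "R2 \<ge> 1" "\<And>u n. solves_d V2 lam u \<Longrightarrow> \<bar>u n\<bar> \<le> (\<bar>u 0\<bar> + \<bar>u 1\<bar>) * R2 ^ n"
    using growth_d[OF bd2, of lam] by blast
  define R where "R = max R1 R2"
  define C where "C = max 1 (\<bar>u 0\<bar> + \<bar>u 1\<bar>)"
  have R: "R \<ge> 1" using R1 by (simp add: R_def)
  have C: "C \<ge> 1" by (simp add: C_def)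
  have le: "\<bar>x\<bar> \<le> C * R ^ n" if "\<bar>x\<bar> \<le> c * r ^ n" "c \<le> C" "1 \<le> r" "r \<le> R" for x c r n
  proof -
    have "c * r ^ n \<le> C * R ^ n" using that C by (intro mult_mono power_mono) auto
    with that(1) show ?thesis by linarith
  qed
  have gu: "\<bar>u n\<bar> \<le> C * R ^ n" for n
    by (rule le[OF R1(2)[OF u]]) (use R1 in \<open>auto simp: C_def R_def\<close>)
  have ga: "\<bar>a2 n\<bar> \<le> C * R ^ n" for n
    by (rule le[OF R2(2)[OF b2.sol(1)]]) (use R2 C in \<open>auto simp: b2.init R_def\<close>)
  have gb: "\<bar>b2 n\<bar> \<le> C * R ^ n" for n
    by (rule le[OF R2(2)[OF b2.sol(2)]]) (use R2 C in \<open>auto simp: b2.init R_def\<close>)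
  define wa wb where "wa n = u n * a2 (Suc n) - u (Suc n) * a2 n"
    and "wb n = u n * b2 (Suc n) - u (Suc n) * b2 n" for n
  obtain a where a: "\<And>\<rho>. \<rho> > 1 \<Longrightarrow> \<exists>D. \<forall>n. \<bar>wa n - a\<bar> \<le> D / \<rho> ^ n"
    using wronskian_limit_d[OF u b2.sol(1) R W gu ga] unfolding wa_def by blast
  obtain b where b: "\<And>\<rho>. \<rho> > 1 \<Longrightarrow> \<exists>D. \<forall>n. \<bar>wb n - b\<bar> \<le> D / \<rho> ^ n"
    using wronskian_limit_d[OF u b2.sol(2) R W gu gb] unfolding wb_def by blast
  have ueq: "u n = wb n * a2 n - wa n * b2 n" for n
  proof -
    have "u n = u n * (a2 n * b2 (Suc n) - a2 (Suc n) * b2 n)" by (simp add: b2.wronskian_basis)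
    then show ?thesis by (simp add: wa_def wb_def algebra_simps)
  qed
  define v where "v n = b * a2 n + (- a) * b2 n" for n
  have decay: "\<exists>D\<ge>0. \<forall>n. \<bar>u n - v n\<bar> \<le> D / \<rho> ^ n" if \<rho>: "\<rho> > 1" for \<rho>
  proof -
    \<comment> \<open>The extra factor \<open>R\<close> compensates the growth of the basis that
      multiplies the Wronskian errors.\<close>
    have "\<rho> * R > 1" using \<rho> R by (simp add: less_1_mult' )
    then obtain Da Db where D: "\<And>n. \<bar>wa n - a\<bar> \<le> Da / (\<rho> * R) ^ n" "\<And>n. \<bar>wb n - b\<bar> \<le> Db / (\<rho> * R) ^ n"
      using a b by meson
    have D0: "Da \<ge> 0" "Db \<ge> 0" using D[of 0] by auto
    have "\<bar>u n - v n\<bar> \<le> (Da + Db) * C / \<rho> ^ n" for n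
    proof -
      have "\<bar>u n - v n\<bar> = \<bar>(wb n - b) * a2 n - (wa n - a) * b2 n\<bar>"
        unfolding ueq[of n] v_def by (simp add: algebra_simps)
      also have "\<dots> \<le> \<bar>wb n - b\<bar> * \<bar>a2 n\<bar> + \<bar>wa n - a\<bar> * \<bar>b2 n\<bar>"
        by (metis abs_mult abs_triangle_ineq4)
      also have "\<dots> \<le> (Db / (\<rho> * R) ^ n) * (C * R ^ n) + (Da / (\<rho> * R) ^ n) * (C * R ^ n)"
        using D[of n] ga[of n] gb[of n] D0 \<rho> R by (intro add_mono mult_mono) auto
      also have "\<dots> = (Da + Db) * C / \<rho> ^ n"
        using \<rho> R by (simp add: power_mult_distrib field_simps)
      finally show ?thesis .
    qed
    with D0 C show ?thesis by (intro exI[of _ "(Da + Db) * C"]) auto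
  qed
  obtain D where D: "\<forall>n. \<bar>u n - v n\<bar> \<le> D / 2 ^ n" using decay[of 2] by auto
  show thesis
  proof (rule that[of v D])
    show "solves_d V2 lam v" unfolding v_def by (rule b2.combination_solves)
    show "\<bar>u n - v n\<bar> \<le> D * (1 / 2) ^ n" for n using D by (simp add: power_divide)
    assume nz: "u 0 \<noteq> 0 \<or> u 1 \<noteq> 0"
    show "v 0 \<noteq> 0 \<or> v 1 \<noteq> 0"
    proof (rule ccontr)
      assume "\<not> ?thesis"
      then have "a = 0" "b = 0" by (auto simp: v_def b2.init)
      then have v0: "v n = 0" for n by (simp add: v_def)
      \<comment> \<open>At this rate the powers of \<open>R\<close> cancel against the growth of a
        solution for \<open>V1\<close>, leaving \<open>(1 / 2) ^ n\<close>.\<close>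
      have "2 * R > 1" using R by simp
      then obtain E where E: "E \<ge> 0" "\<And>n. \<bar>u n\<bar> \<le> E / (2 * R) ^ n"
        using decay[of "2 * R"] by (auto simp: v0)
      \<comment> \<open>Both basis solutions satisfy this normalization, which makes the constant in
        their growth bound equal to 1.\<close>
      have z: "u 0 * y 1 - u 1 * y 0 = 0" if y: "solves_d V1 lam y" "\<bar>y 0\<bar> + \<bar>y 1\<bar> = 1" for y
      proof -
        have gy: "\<bar>y n\<bar> \<le> R ^ n" for n
        proof -
          have "\<bar>y n\<bar> \<le> R1 ^ n" using R1(2)[OF y(1), of n] y(2) by simp
          also have "\<dots> \<le> R ^ n" using R1 by (intro power_mono) (auto simp: R_def)
          finally show ?thesis .
        qed
        have "\<bar>u 0 * y 1 - u 1 * y 0\<bar> \<le> E * (R + 1) * (1 / 2) ^ n" for n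
        proof -
          have "\<bar>u 0 * y 1 - u 1 * y 0\<bar> = \<bar>u n * y (Suc n) - u (Suc n) * y n\<bar>"
            using wronskian_const_d[OF u y(1), of n] by simp
          also have "\<dots> \<le> \<bar>u n\<bar> * \<bar>y (Suc n)\<bar> + \<bar>u (Suc n)\<bar> * \<bar>y n\<bar>"
            by (metis abs_mult abs_triangle_ineq4)
          also have "\<dots> \<le> (E / (2 * R) ^ n) * R ^ Suc n + (E / (2 * R) ^ Suc n) * R ^ n"
            using E(1) R by (intro add_mono mult_mono gy E(2)) auto
          also have "\<dots> = E * (R + 1 / (2 * R)) * (1 / 2) ^ n"
            using R by (simp add: power_mult_distrib power_divide field_simps)
          also have "\<dots> \<le> E * (R + 1) * (1 / 2) ^ n"
            using R E by (intro mult_right_mono mult_left_mono) (auto simp: field_simps)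
          finally show ?thesis .
        qed
        moreover have "(\<lambda>n. E * (R + 1) * (1 / 2) ^ n) \<longlonglongrightarrow> E * (R + 1) * 0"
          by (intro tendsto_mult_left LIMSEQ_realpow_zero) auto
        ultimately have "\<bar>u 0 * y 1 - u 1 * y 0\<bar> \<le> E * (R + 1) * 0"
          by (intro tendsto_lowerbound[of _ _ sequentially]) auto
        then show ?thesis by simp
      qed
      have "u 1 = 0" "u 0 = 0"
        using z[OF b1.sol(1)] z[OF b1.sol(2)] by simp_all
      with nz show False by simp
    qed
  qed
qed

lemma P_d_perturb:
  assumes bd1: "bounded (V1 ` {1..})" and bd2: "bounded (V2 ` {1..})"
    and W: "\<And>\<rho>. \<rho> > 1 \<Longrightarrow> summable (\<lambda>n. \<bar>V2 (Suc n) - V1 (Suc n)\<bar> * \<rho> ^ n)"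
  shows "P_d V1 \<subseteq> P_d V2"
proof
  fix lam assume "lam \<in> P_d V1"
  then obtain u v where uv: "solves_d V1 lam u" "u 0 \<noteq> 0 \<or> u 1 \<noteq> 0" "L2_d u"
    "solves_d V1 lam v" "\<not> L2_d v"
    unfolding P_d_iff by blast
  obtain p D where p: "solves_d V2 lam p" "\<And>n. \<bar>u n - p n\<bar> \<le> D * (1 / 2) ^ n"
    "u 0 \<noteq> 0 \<or> u 1 \<noteq> 0 \<Longrightarrow> p 0 \<noteq> 0 \<or> p 1 \<noteq> 0"
    using asymptotic_solution_d[OF bd1 bd2 W uv(1)] by blast
  obtain r E where r: "solves_d V2 lam r" "\<And>n. \<bar>v n - r n\<bar> \<le> E * (1 / 2) ^ n"
    using asymptotic_solution_d[OF bd1 bd2 W uv(4)] by blast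
  have "L2_d p" using L2_d_perturb[OF uv(3) p(2)] .
  moreover have "\<not> L2_d r"
    using L2_d_perturb[of r v E] r(2) uv(5) by (auto simp: abs_minus_commute)
  ultimately show "lam \<in> P_d V2"
    unfolding P_d_iff using p(1,3) uv(2) r(1) by blast
qed

lemma P_d_eq:
  assumes V0: "bounded (V0 ` {1..})"
    and W: "\<And>A::real. A > 0 \<Longrightarrow> (\<lambda>n. \<bar>W n\<bar> * exp (A * real n)) summable_on {1..}"
  shows "P_d V0 = P_d (\<lambda>n. V0 n + W n)"
proof -
  have s: "summable (\<lambda>n. \<bar>W (Suc n)\<bar> * \<rho> ^ n)" if \<rho>: "\<rho> > 1" for \<rho>
  proof -
    \<comment> \<open>The choice \<open>A = ln \<rho>\<close>, positive because
      \<open>\<rho> > 1\<close>, turns exponential weights into powers of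
      \<open>\<rho>\<close>.\<close>
    have "(\<lambda>n. \<bar>W n\<bar> * exp (ln \<rho> * real n)) summable_on {1..}" using \<rho> by (intro W) simp
    also have "(\<lambda>n. \<bar>W n\<bar> * exp (ln \<rho> * real n)) = (\<lambda>n. \<bar>W n\<bar> * \<rho> ^ n)"
      using \<rho> by (simp add: mult.commute[of "ln _"] exp_of_nat_mult)
    also have "{1..} = Suc ` UNIV" by (auto simp: image_iff Suc_le_eq gr0_conv_Suc)
    finally have "(\<lambda>n. \<bar>W n\<bar> * \<rho> ^ n) summable_on Suc ` UNIV" .
    then have "(\<lambda>n. \<bar>W (Suc n)\<bar> * \<rho> ^ Suc n) summable_on UNIV"
      by (subst (asm) summable_on_reindex) (auto simp: o_def)
    then have "summable (\<lambda>n. \<bar>W (Suc n)\<bar> * \<rho> ^ Suc n)" by (rule summable_on_imp_summable)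
    then show ?thesis
      by (rule summable_comparison_test') (use \<rho> in \<open>auto simp: abs_mult mult_le_cancel_left1 intro!: mult_left_mono\<close>)
  qed
  \<comment> \<open>The terms of a convergent series are bounded, hence \<open>W\<close> is bounded
    on \<open>{1..}\<close> and \<open>V0 + W\<close> admits the growth estimate.\<close>
  have "(\<lambda>n. \<bar>W (Suc n)\<bar> * 2 ^ n) \<longlonglongrightarrow> 0" using s[of 2] by (intro summable_LIMSEQ_zero) auto
  then obtain K where K: "\<And>n. \<bar>W (Suc n)\<bar> * 2 ^ n \<le> K"
    using convergent_imp_Bseq[of "\<lambda>n. \<bar>W (Suc n)\<bar> * 2 ^ n"] by (auto simp: convergent_def Bseq_def)
  have "\<bar>W n\<bar> \<le> K" if n: "n \<ge> 1" for n
  proof -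
    obtain m where m: "n = Suc m" using n by (cases n) auto
    have "\<bar>W (Suc m)\<bar> * 1 \<le> \<bar>W (Suc m)\<bar> * 2 ^ m" by (intro mult_left_mono) auto
    with K[of m] m show ?thesis by simp
  qed
  then have "bounded (W ` {1..})" by (auto simp: bounded_iff)
  then have V: "bounded ((\<lambda>n. V0 n + W n) ` {1..})"
    using V0 by (intro bounded_plus_comp) auto
  show ?thesis
  proof
    show "P_d V0 \<subseteq> P_d (\<lambda>n. V0 n + W n)" using s by (intro P_d_perturb V0 V) simp
    show "P_d (\<lambda>n. V0 n + W n) \<subseteq> P_d V0" using s by (intro P_d_perturb V0 V) simp
  qed
qed

section \<open>Invariance under superexponentially decaying perturbations\<close>

theorem corollary1p8:
  shows "(\<forall>V0 W :: real \<Rightarrow> real.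
            potential_c V0 \<and> bounded_c V0 \<and> potential_c W \<and>
            (\<forall>A>0. (\<lambda>x. \<bar>W x\<bar> * exp (A * \<bar>x\<bar>)) absolutely_integrable_on {0..}) \<longrightarrow>
            P_c V0 = P_c (\<lambda>x. V0 x + W x)) \<and>
         (\<forall>V0 W :: nat \<Rightarrow> real.
            bounded (V0 ` {1..}) \<and>
            (\<forall>A::real. A > 0 \<longrightarrow> (\<lambda>n. \<bar>W n\<bar> * exp (A * real n)) summable_on {1..}) \<longrightarrow>
            P_d V0 = P_d (\<lambda>n. V0 n + W n))"
proof (intro conjI allI impI)
  fix V0 W :: "real \<Rightarrow> real"
  assume "potential_c V0 \<and> bounded_c V0 \<and> potential_c W \<and>
    (\<forall>A>0. (\<lambda>x. \<bar>W x\<bar> * exp (A * \<bar>x\<bar>)) absolutely_integrable_on {0..})"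
  then show "P_c V0 = P_c (\<lambda>x. V0 x + W x)" by (intro P_c_eq) auto
next
  fix V0 W :: "nat \<Rightarrow> real"
  assume "bounded (V0 ` {1..}) \<and>
    (\<forall>A::real. A > 0 \<longrightarrow> (\<lambda>n. \<bar>W n\<bar> * exp (A * real n)) summable_on {1..})"
  then show "P_d V0 = P_d (\<lambda>n. V0 n + W n)" by (intro P_d_eq) auto
qed

end
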